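(* Let $\Bbbk$ be a field and let $G$ be a perfect graph whose maximal cliques are $Q_0,Q_1,\dots,Q_n$ (pairwise distinct). Then $\mathrm{Cl}(\Bbbk[\mathrm{Stab}_G])\cong\mathbb{Z}^n$. In particular, $\mathrm{Cl}(\Bbbk[\mathrm{Stab}_G])$ is torsionfree.
   Context: All graphs are finite and simple, with vertex set $[d]=\{1,\dots,d\}$. A clique is a set of pairwise adjacent vertices; maximal means with respect to inclusion. A stable set is a set of pairwise non-adjacent vertices (the empty set and singletons are included). For $W\subset[d]$, $\rho(W)=\sum_{i\in W}\mathbf{e}_i$. The stable set polytope is $\mathrm{Stab}_G=\mathrm{conv}\{\rho(W): W\text{ is a stable set of }G\}\subset\mathbb{R}^d$, and its toric ring (the stable set ring) is $\Bbbk[\mathrm{Stab}_G]=\Bbbk[\mathbf{x}^{\mathbf{a}}t:\mathbf{a}\in\mathrm{Stab}_G\cap\mathbb{Z}^d]$, which is a normal domain when $G$ is perfect. $\mathrm{Cl}(R)$ denotes the (divisor) class group of a normal domain $R$. *)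

theory Defs
  imports
    "HOL-Analysis.Analysis"
    "HOL-Algebra.Algebra"
    "HOL-Library.Poly_Mapping"
    "HOL-Computational_Algebra.Polynomial"
    "HOL-Computational_Algebra.Fraction_Field"
begin

text \<open>
  A graph on \<open>[d]\<close> is a symmetric irreflexive relation \<open>E\<close> on a finite linearly ordered type
  \<open>'v\<close> with \<open>d\<close> elements. The order is that of \<open>[d]\<close>; its only use is to provide the
  \<open>idom\<close> instance of the Laurent polynomial ring below.
\<close>

definition simple_graph :: "('v \<Rightarrow> 'v \<Rightarrow> bool) \<Rightarrow> bool" where
  "simple_graph E \<longleftrightarrow> symp E \<and> irreflp E"

definition clique :: "('v \<Rightarrow> 'v \<Rightarrow> bool) \<Rightarrow> 'v set \<Rightarrow> bool" where
  "clique E C \<longleftrightarrow> pairwise E C"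

definition maximal_clique :: "('v \<Rightarrow> 'v \<Rightarrow> bool) \<Rightarrow> 'v set \<Rightarrow> bool" where
  "maximal_clique E C \<longleftrightarrow> clique E C \<and> (\<forall>D. clique E D \<and> C \<subseteq> D \<longrightarrow> D = C)"

definition stable_set :: "('v \<Rightarrow> 'v \<Rightarrow> bool) \<Rightarrow> 'v set \<Rightarrow> bool" where
  "stable_set E W \<longleftrightarrow> pairwise (\<lambda>u v. \<not> E u v) W"

text \<open>Clique number and chromatic number of the subgraph induced on \<open>W\<close>.\<close>

definition clique_number :: "('v::finite \<Rightarrow> 'v \<Rightarrow> bool) \<Rightarrow> 'v set \<Rightarrow> nat" where
  "clique_number E W = Max (card ` {C. C \<subseteq> W \<and> clique E C})"

definition proper_colouring :: "('v \<Rightarrow> 'v \<Rightarrow> bool) \<Rightarrow> 'v set \<Rightarrow> nat \<Rightarrow> ('v \<Rightarrow> nat) \<Rightarrow> bool" where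
  "proper_colouring E W k c \<longleftrightarrow>
     c ` W \<subseteq> {..<k} \<and> (\<forall>u\<in>W. \<forall>v\<in>W. E u v \<longrightarrow> c u \<noteq> c v)"

definition chromatic_number :: "('v::finite \<Rightarrow> 'v \<Rightarrow> bool) \<Rightarrow> 'v set \<Rightarrow> nat" where
  "chromatic_number E W = (LEAST k. \<exists>c. proper_colouring E W k c)"

definition perfect_graph :: "('v::finite \<Rightarrow> 'v \<Rightarrow> bool) \<Rightarrow> bool" where
  "perfect_graph E \<longleftrightarrow> (\<forall>W. chromatic_number E W = clique_number E W)"

definition incidence_vector :: "'v::finite set \<Rightarrow> real ^ 'v" where
  "incidence_vector W = (\<Sum>i\<in>W. axis i 1)"

definition stable_set_polytope :: "('v::finite \<Rightarrow> 'v \<Rightarrow> bool) \<Rightarrow> (real ^ 'v) set" where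
  "stable_set_polytope E = convex hull (incidence_vector ` {W. stable_set E W})"

text \<open>
  \<open>('v \<Rightarrow>\<^sub>0 int) \<Rightarrow>\<^sub>0 'k\<close> is the Laurent polynomial ring in the variables \<open>x\<^sub>i\<close>, where
  \<open>Poly_Mapping.single a c\<close> is \<open>c x\<^sup>a\<close>; the variable of the outer univariate polynomials is \<open>t\<close>.
\<close>

type_synonym ('v, 'k) laurent_t = "(('v \<Rightarrow>\<^sub>0 int) \<Rightarrow>\<^sub>0 'k) poly"

definition lattice_point :: "('v::finite \<Rightarrow>\<^sub>0 int) \<Rightarrow> real ^ 'v" where
  "lattice_point a = (\<chi> i. real_of_int (Poly_Mapping.lookup a i))"

inductive_set toric_algebra :: "(real ^ 'v::{finite,linorder}) set \<Rightarrow> ('v, 'k::field) laurent_t set"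
  for P where
  scalar: "[:Poly_Mapping.single 0 c:] \<in> toric_algebra P"
| gen: "lattice_point a \<in> P \<Longrightarrow> Polynomial.monom (Poly_Mapping.single a 1) 1 \<in> toric_algebra P"
| add: "p \<in> toric_algebra P \<Longrightarrow> q \<in> toric_algebra P \<Longrightarrow> p + q \<in> toric_algebra P"
| mult: "p \<in> toric_algebra P \<Longrightarrow> q \<in> toric_algebra P \<Longrightarrow> p * q \<in> toric_algebra P"

text \<open>The toric ring, regarded as a subring of the field of fractions of the ambient ring.\<close>

definition toric_ring ::
  "'k::field itself \<Rightarrow> (real ^ 'v::{finite,linorder}) set \<Rightarrow> ('v, 'k) laurent_t fract set" where
  "toric_ring _ P = (\<lambda>p. Fract p 1) ` toric_algebra P"

definition stable_set_ring ::
  "'k::field itself \<Rightarrow> ('v::{finite,linorder} \<Rightarrow> 'v \<Rightarrow> bool) \<Rightarrow> ('v, 'k) laurent_t fract set" where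
  "stable_set_ring K E = toric_ring K (stable_set_polytope E)"

text \<open>
  The divisor class group of a normal domain \<open>A\<close>, given as a subring of some field: the group
  of divisorial fractional ideals (with product \<open>A : (A : IJ)\<close>) modulo the principal ones.
  Everything takes place inside \<open>frac_field A\<close>, which may be smaller than the surrounding field.
\<close>

definition frac_field :: "'f::field set \<Rightarrow> 'f set" where
  "frac_field A = {a / b | a b. a \<in> A \<and> b \<in> A \<and> b \<noteq> 0}"

definition fractional_ideal :: "'f::field set \<Rightarrow> 'f set \<Rightarrow> bool" where
  "fractional_ideal A I \<longleftrightarrow>
     I \<subseteq> frac_field A \<and> 0 \<in> I \<and>
     (\<forall>x\<in>I. \<forall>y\<in>I. x + y \<in> I) \<and> (\<forall>a\<in>A. \<forall>x\<in>I. a * x \<in> I) \<and>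
     (\<exists>d\<in>A. d \<noteq> 0 \<and> (\<forall>x\<in>I. d * x \<in> A))"

definition colon :: "'f::field set \<Rightarrow> 'f set \<Rightarrow> 'f set" where
  "colon A I = {x \<in> frac_field A. \<forall>y\<in>I. x * y \<in> A}"

definition divisorial_ideal :: "'f::field set \<Rightarrow> 'f set \<Rightarrow> bool" where
  "divisorial_ideal A I \<longleftrightarrow> fractional_ideal A I \<and> I \<noteq> {0} \<and> colon A (colon A I) = I"

definition ideal_mult :: "'f::field set \<Rightarrow> 'f set \<Rightarrow> 'f set" where
  "ideal_mult I J = {\<Sum>i<(m::nat). f i * g i | m f g. \<forall>i<m. f i \<in> I \<and> g i \<in> J}"

definition divisor_group :: "'f::field set \<Rightarrow> 'f set monoid" where
  "divisor_group A =
     \<lparr>carrier = {I. divisorial_ideal A I},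
      monoid.mult = (\<lambda>I J. colon A (colon A (ideal_mult I J))),
      one = A\<rparr>"

definition principal_divisors :: "'f::field set \<Rightarrow> 'f set set" where
  "principal_divisors A = {(*) x ` A | x. x \<in> frac_field A \<and> x \<noteq> 0}"

definition class_group :: "'f::field set \<Rightarrow> 'f set set monoid" where
  "class_group A = divisor_group A Mod principal_divisors A"

definition torsion_free :: "('a, 'b) monoid_scheme \<Rightarrow> bool" where
  "torsion_free H \<longleftrightarrow>
     (\<forall>x\<in>carrier H. \<forall>m::nat. m > 0 \<longrightarrow> x [^]\<^bsub>H\<^esub> m = \<one>\<^bsub>H\<^esub> \<longrightarrow> x = \<one>\<^bsub>H\<^esub>)"

end

theory Submission
  imports Defs
begin

text \<open>
  The stable set ring is the semigroup ring of the lattice points of a cone with one facet for each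
  vertex and one for each maximal clique; this is where perfection enters, through weighted
  colourings. Inverting the monomials gives a Laurent polynomial ring, a unique factorisation domain,
  so up to principal ideals every divisorial ideal is spanned by the monomials satisfying a shifted
  system of facet inequalities, and the class group is the cokernel of the map
  \<open>u \<mapsto> (\<sigma>\<^sub>i(u))\<^sub>i\<close> from the lattice to \<open>\<int>\<close>-valued functions on the facets. The vertex facets
  together with the facet of \<open>Q 0\<close> are coordinates on the lattice, which leaves one free generator
  for each of \<open>Q 1, \<dots>, Q n\<close>.
\<close>

section \<open>Rings with greatest common divisors and Laurent extensions\<close>

text \<open>The Laurent ring enters through one property, the existence of greatest common divisors
  for arbitrary nonzero subsets. This is the right strength because a divisorial ideal is cut out by
  a possibly infinite set of multipliers, and the property passes from \<open>R\<close> to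
  \<open>R[x, 1/x]\<close> by Gauss's lemma. Valuations appear as lowest
  \<open>\<sigma>\<close>-degrees of Laurent polynomials. Two facts make the cokernel exact. Each
  facet inequality can be made tight while all others keep prescribed bounds, so the exponents of a
  monomial ideal can be read off from it. And units of the Laurent ring are monomials up to scalars,
  so the relations between classes come from the lattice alone. On the combinatorial side the
  polytope is given by its vertices, whereas facets are visible only in a description by
  inequalities. The two are compared on lattice points of the cone, by covers with stable
  sets.\<close>

locale subring_of_field =
  fixes R :: "'f::field set"
  assumes one_mem: "1 \<in> R"
    and diff_mem: "\<lbrakk>x \<in> R; y \<in> R\<rbrakk> \<Longrightarrow> x - y \<in> R"
    and mult_mem: "\<lbrakk>x \<in> R; y \<in> R\<rbrakk> \<Longrightarrow> x * y \<in> R"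
begin

lemma zero_mem: "0 \<in> R"
  using diff_mem[OF one_mem one_mem] by simp

lemma uminus_mem: "x \<in> R \<Longrightarrow> - x \<in> R"
  using diff_mem[OF zero_mem] by simp

lemma add_mem: "x \<in> R \<Longrightarrow> y \<in> R \<Longrightarrow> x + y \<in> R"
  using diff_mem[OF _ uminus_mem] by fastforce

lemma sum_mem: "(\<And>i. i \<in> A \<Longrightarrow> f i \<in> R) \<Longrightarrow> sum f A \<in> R"
  by (induction A rule: infinite_finite_induct) (auto intro: zero_mem add_mem)

section \<open>Polynomials over a subring and Laurent extensions\<close>

definition polys :: "'f poly set" where
  "polys = {p. \<forall>i. Polynomial.coeff p i \<in> R}"

lemma coeff_mem: "p \<in> polys \<Longrightarrow> Polynomial.coeff p i \<in> R"
  by (simp add: polys_def)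

lemma polys_zero: "0 \<in> polys"
  by (simp add: polys_def zero_mem)

lemma polys_one: "1 \<in> polys"
  by (simp add: polys_def zero_mem one_mem Polynomial.coeff_1)

lemma polys_add: "p \<in> polys \<Longrightarrow> q \<in> polys \<Longrightarrow> p + q \<in> polys"
  by (simp add: polys_def add_mem)

lemma polys_diff: "p \<in> polys \<Longrightarrow> q \<in> polys \<Longrightarrow> p - q \<in> polys"
  by (simp add: polys_def diff_mem)

lemma polys_mult: "p \<in> polys \<Longrightarrow> q \<in> polys \<Longrightarrow> p * q \<in> polys"
  by (simp add: polys_def Polynomial.coeff_mult sum_mem mult_mem)

lemma polys_smult: "c \<in> R \<Longrightarrow> p \<in> polys \<Longrightarrow> Polynomial.smult c p \<in> polys"
  by (simp add: polys_def mult_mem)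

lemma polys_monom: "c \<in> R \<Longrightarrow> Polynomial.monom c n \<in> polys"
  by (simp add: polys_def zero_mem)

lemma polys_const: "c \<in> R \<Longrightarrow> [:c:] \<in> polys"
  using polys_monom[of c 0] by (simp add: Polynomial.monom_0)

text \<open>Says that the content is a unit; \<open>y\<close> ranges over the field, so that
  divisibility by \<open>c\<close> can be tested at \<open>y = 1 / c\<close>.\<close>

definition primitive :: "'f poly \<Rightarrow> bool" where
  "primitive p \<longleftrightarrow> p \<in> polys \<and> p \<noteq> 0 \<and> (\<forall>y. Polynomial.smult y p \<in> polys \<longrightarrow> y \<in> R)"

text \<open>The ring \<open>R[x, 1/x]\<close> as a set of values. Transcendence of \<open>x\<close>
  is assumed only where polynomials must be recovered from their values.\<close>

definition laurent_ext :: "'f \<Rightarrow> 'f set" where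
  "laurent_ext x = {Polynomial.poly p x / x ^ m | p m. p \<in> polys}"

lemma laurent_extI: "p \<in> polys \<Longrightarrow> Polynomial.poly p x / x ^ m \<in> laurent_ext x"
  by (auto simp: laurent_ext_def)

lemma laurent_extI': "p \<in> polys \<Longrightarrow> Polynomial.poly p x \<in> laurent_ext x"
  using laurent_extI[of p x 0] by simp

lemma subring_laurent_ext:
  assumes "x \<noteq> 0"
  shows "subring_of_field (laurent_ext x)"
proof
  show "1 \<in> laurent_ext x"
    using laurent_extI'[OF polys_one] by simp
next
  fix a b assume "a \<in> laurent_ext x" "b \<in> laurent_ext x"
  then obtain p m q n where
    ab: "p \<in> polys" "a = Polynomial.poly p x / x ^ m" "q \<in> polys" "b = Polynomial.poly q x / x ^ n"
    by (auto simp: laurent_ext_def)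
  have "a - b = Polynomial.poly (p * Polynomial.monom 1 n - q * Polynomial.monom 1 m) x / x ^ (m + n)"
    using assms by (simp add: ab field_simps power_add Polynomial.poly_monom)
  then show "a - b \<in> laurent_ext x"
    using laurent_extI[OF polys_diff[OF polys_mult polys_mult]] ab polys_monom one_mem by metis
  have "a * b = Polynomial.poly (p * q) x / x ^ (m + n)"
    by (simp add: ab power_add)
  then show "a * b \<in> laurent_ext x"
    using laurent_extI[OF polys_mult] ab by metis
qed

end

text \<open>
  Every nonzero subset of \<open>R\<close> has a greatest common divisor. Dividing by \<open>y\<close>, the condition says that
  \<open>g\<close> generates the smallest divisorial ideal containing \<open>S\<close>; letting \<open>y\<close> range over the whole
  surrounding field avoids mentioning the field of fractions of \<open>R\<close>.
\<close>

locale complete_gcd_ring = subring_of_field +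
  assumes ex_gcd:
    "\<lbrakk>S \<subseteq> R; \<not> S \<subseteq> {0}\<rbrakk> \<Longrightarrow> \<exists>g. g \<noteq> 0 \<and> (\<forall>y. (\<forall>s\<in>S. y * s \<in> R) \<longleftrightarrow> y * g \<in> R)"
begin

section \<open>Contents, primitive polynomials and Gauss's lemma\<close>

lemma ex_content:
  assumes "P \<subseteq> polys" "\<not> P \<subseteq> {0}"
  obtains g where "g \<in> R" "g \<noteq> 0" "\<And>y. (\<forall>p\<in>P. Polynomial.smult y p \<in> polys) \<longleftrightarrow> y * g \<in> R"
proof -
  let ?S = "{Polynomial.coeff p i | p i. p \<in> P}"
  obtain p where "p \<in> P" "p \<noteq> 0"
    using assms(2) by auto
  then have "Polynomial.coeff p (Polynomial.degree p) \<in> ?S" "Polynomial.coeff p (Polynomial.degree p) \<noteq> 0"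
    by auto
  then have "\<not> ?S \<subseteq> {0}"
    by blast
  moreover have "?S \<subseteq> R"
    using assms(1) by (auto intro: coeff_mem)
  ultimately obtain g where "g \<noteq> 0" and g: "\<And>y. (\<forall>s\<in>?S. y * s \<in> R) \<longleftrightarrow> y * g \<in> R"
    using ex_gcd[of ?S] by blast
  have *: "(\<forall>p\<in>P. Polynomial.smult y p \<in> polys) \<longleftrightarrow> y * g \<in> R" for y
    unfolding g[symmetric] by (auto simp: polys_def)
  moreover have "g \<in> R"
    using *[of 1] assms(1) by auto
  ultimately show thesis
    using that \<open>g \<noteq> 0\<close> by blast
qed

lemma primitive_part:
  assumes "p \<in> polys" "p \<noteq> 0"
  obtains c q where "c \<in> R" "c \<noteq> 0" "p = Polynomial.smult c q" "primitive q"
proof -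
  obtain c where c: "c \<in> R" "c \<noteq> 0" "\<And>y. Polynomial.smult y p \<in> polys \<longleftrightarrow> y * c \<in> R"
    using ex_content[of "{p}"] assms by auto
  have "Polynomial.smult (1 / c) p \<in> polys"
    using c one_mem by simp
  moreover have "y \<in> R" if "Polynomial.smult y (Polynomial.smult (1 / c) p) \<in> polys" for y
    using that c(2) c(3)[of "y / c"] by simp
  ultimately have "primitive (Polynomial.smult (1 / c) p)"
    using assms c(2) by (simp add: primitive_def)
  with c show thesis
    using that[of c "Polynomial.smult (1 / c) p"] by simp
qed

text \<open>
  Gauss's lemma without prime elements: a common divisor of the coefficients of \<open>p * q\<close> and of the
  leading coefficient of \<open>p\<close> divides \<open>(p - lead term) * q\<close>, so by induction it is a unit.
\<close>

lemma coprime_lead_coeff: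
  assumes p: "primitive p" and q: "primitive q" and c: "c \<in> R"
    and pq: "\<And>y. Polynomial.smult y (p * q) \<in> polys \<longleftrightarrow> y * c \<in> R"
    and IH: "\<And>r. Polynomial.degree r < Polynomial.degree p \<Longrightarrow> primitive r \<Longrightarrow> primitive (r * q)"
    and y: "y * c \<in> R" "y * Polynomial.lead_coeff p \<in> R"
  shows "y \<in> R"
proof -
  have pp: "p \<in> polys" "p \<noteq> 0" "q \<in> polys" "q \<noteq> 0"
    using p q by (auto simp: primitive_def)
  let ?l = "Polynomial.monom (Polynomial.lead_coeff p) (Polynomial.degree p)"
  define r where "r = p - ?l"
  have r: "r \<in> polys"
    using pp by (auto simp: r_def intro!: polys_diff polys_monom coeff_mem)
  have l: "Polynomial.smult y ?l \<in> polys"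
    using y(2) by (simp add: Polynomial.smult_monom polys_monom)
  have "Polynomial.smult y r \<in> polys"
  proof (cases "r = 0")
    case False
    then obtain e s where e: "e \<in> R" "e \<noteq> 0" "r = Polynomial.smult e s" "primitive s"
      using primitive_part r by blast
    have "Polynomial.degree r < Polynomial.degree p"
    proof -
      have "Polynomial.degree r \<noteq> Polynomial.degree p"
      proof
        assume "Polynomial.degree r = Polynomial.degree p"
        then have "Polynomial.lead_coeff r = 0"
          by (simp add: r_def)
        with False show False by simp
      qed
      moreover have "Polynomial.degree r \<le> Polynomial.degree p"
        unfolding r_def by (rule Polynomial.degree_diff_le) (auto simp: Polynomial.degree_monom_le)
      ultimately show ?thesis by simp
    qed
    then have sq: "primitive (s * q)"
      using e by (intro IH) auto
    have "Polynomial.smult y (r * q) = Polynomial.smult y (p * q) - Polynomial.smult y ?l * q"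
      by (simp add: r_def algebra_simps Polynomial.smult_diff_right)
    also have "\<dots> \<in> polys"
      using pq y(1) l pp by (intro polys_diff polys_mult) auto
    finally have "y * e \<in> R"
      using sq e by (simp add: primitive_def)
    then show ?thesis
      using e polys_smult[of "y * e" s] by (simp add: primitive_def)
  qed (simp add: polys_zero)
  then have "Polynomial.smult y r + Polynomial.smult y ?l \<in> polys"
    using l by (rule polys_add)
  then have "Polynomial.smult y p \<in> polys"
    by (simp add: r_def flip: Polynomial.smult_add_right)
  then show ?thesis
    using p by (simp add: primitive_def)
qed

text \<open>The content \<open>c\<close> of \<open>p * q\<close> divides the product of the two
  leading coefficients, yet is coprime to each of them, so \<open>1 / c\<close> lies in
  \<open>R\<close>. The induction is on the sum of the degrees because coprimality is needed for
  both factors.\<close>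

lemma primitive_mult: "primitive p \<Longrightarrow> primitive q \<Longrightarrow> primitive (p * q)"
proof (induction "Polynomial.degree p + Polynomial.degree q" arbitrary: p q rule: less_induct)
  case less
  have pp: "p \<in> polys" "p \<noteq> 0" "q \<in> polys" "q \<noteq> 0"
    using less.prems by (auto simp: primitive_def)
  then have pq: "p * q \<in> polys" "p * q \<noteq> 0"
    by (auto intro: polys_mult)
  obtain c where c: "c \<in> R" "c \<noteq> 0" "\<And>y. Polynomial.smult y (p * q) \<in> polys \<longleftrightarrow> y * c \<in> R"
    using ex_content[of "{p * q}"] pq by auto
  have IH1: "primitive (r * q)" if "Polynomial.degree r < Polynomial.degree p" "primitive r" for r
    using less that by simp
  have IH2: "primitive (r * p)" if "Polynomial.degree r < Polynomial.degree q" "primitive r" for r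
    using less that by simp
  have 1: "y \<in> R" if "y * c \<in> R" "y * Polynomial.lead_coeff p \<in> R" for y
    using coprime_lead_coeff[OF less.prems c(1,3) IH1 that] .
  have 2: "y \<in> R" if "y * c \<in> R" "y * Polynomial.lead_coeff q \<in> R" for y
    using coprime_lead_coeff[OF less.prems(2,1) c(1) c(3)[unfolded mult.commute[of p q]] IH2 that] by (simp add: mult.commute)
  let ?y = "1 / c"
  have "?y \<in> R"
  proof (rule 1)
    show "?y * c \<in> R" using c one_mem by simp
    show "?y * Polynomial.lead_coeff p \<in> R"
    proof (rule 2)
      show "?y * Polynomial.lead_coeff p * c \<in> R"
        using c pp coeff_mem by simp
      have "Polynomial.smult ?y (p * q) \<in> polys"
        using c one_mem by simp
      then have "Polynomial.coeff (Polynomial.smult ?y (p * q)) (Polynomial.degree p + Polynomial.degree q) \<in> R"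
        by (rule coeff_mem)
      then show "?y * Polynomial.lead_coeff p * Polynomial.lead_coeff q \<in> R"
        by (simp add: Polynomial.coeff_mult_degree_sum mult.assoc)
    qed
  qed
  have "y \<in> R" if "Polynomial.smult y (p * q) \<in> polys" for y
    using that c mult_mem[OF _ \<open>?y \<in> R\<close>, of "y * c"] by simp
  with pq show ?case
    by (simp add: primitive_def)
qed

text \<open>If \<open>c\<close> is the content of \<open>s\<close>, then \<open>q\<close> times the
  primitive part of \<open>s\<close> is primitive, which forces \<open>y * c\<close> into
  \<open>R\<close>. A primitive factor can thus be cancelled even under a fractional scalar.\<close>

lemma gauss:
  assumes "primitive q" "s \<in> polys" "Polynomial.smult y (q * s) \<in> polys"
  shows "Polynomial.smult y s \<in> polys"
proof (cases "s = 0")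
  case False
  then obtain c r where c: "c \<in> R" "c \<noteq> 0" "s = Polynomial.smult c r" "primitive r"
    using primitive_part assms(2) by blast
  then have "y * c \<in> R"
    using assms primitive_mult[OF assms(1) c(4)] by (simp add: primitive_def)
  then show ?thesis
    using c polys_smult[of "y * c" r] by (simp add: primitive_def)
qed (simp add: polys_zero)

text \<open>Pseudo-division by an element \<open>h\<close> of least degree in the ideal
  \<open>I\<close>. The leading coefficient introduced by it is removed again by Gauss's lemma,
  since the divisor \<open>h'\<close> is primitive.\<close>

lemma primitive_dvd:
  assumes I: "I \<subseteq> polys" "\<And>p q. p \<in> I \<Longrightarrow> q \<in> I \<Longrightarrow> p - q \<in> I" "\<And>p q. p \<in> I \<Longrightarrow> q \<in> polys \<Longrightarrow> q * p \<in> I"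
    and h: "h \<in> I" "h \<noteq> 0" "h = Polynomial.smult c h'" "c \<in> R" "primitive h'"
    and min: "\<And>p. p \<in> I \<Longrightarrow> p \<noteq> 0 \<Longrightarrow> Polynomial.degree h \<le> Polynomial.degree p"
    and s: "s \<in> I"
  shows "\<exists>q\<in>polys. s = h' * q"
  using s
proof (induction "Polynomial.degree s" arbitrary: s rule: less_induct)
  case less
  let ?l = "Polynomial.lead_coeff h"
  have hp: "h \<in> polys" and sp: "s \<in> polys" and hp': "h' \<in> polys"
    using I h less.prems by (auto simp: primitive_def)
  have "\<exists>q\<in>polys. Polynomial.smult ?l s = h' * q"
  proof (cases "s = 0")
    case True
    then show ?thesis by (auto intro!: bexI[of _ 0] polys_zero)
  next
    case False
    then have deg: "Polynomial.degree h \<le> Polynomial.degree s"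
      using min less.prems by blast
    \<comment> \<open>\<open>m * h\<close> has the same leading term as \<open>?l\<close> times
      \<open>s\<close>, so the remainder \<open>r\<close> drops in degree.\<close>
    define m where "m = Polynomial.monom (Polynomial.lead_coeff s) (Polynomial.degree s - Polynomial.degree h)"
    have m: "m \<in> polys" "m \<noteq> 0"
      using sp False by (auto simp: m_def intro!: polys_monom coeff_mem)
    define r where "r = [:?l:] * s - m * h"
    have r: "r \<in> I"
      unfolding r_def using m hp less.prems h(1)
      by (intro I(2) I(3)) (auto intro!: polys_const coeff_mem)
    have "\<exists>q\<in>polys. r = h' * q"
    proof (cases "r = 0")
      case True
      then show ?thesis by (auto intro!: bexI[of _ 0] polys_zero)
    next
      case False
      have mh: "Polynomial.degree (m * h) = Polynomial.degree s"
        using deg m h(2) \<open>s \<noteq> 0\<close> by (subst Polynomial.degree_mult_eq) (auto simp: m_def Polynomial.degree_monom_eq)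
      have "Polynomial.coeff (m * h) (Polynomial.degree s) = Polynomial.lead_coeff m * ?l"
        unfolding mh[symmetric] by (rule Polynomial.lead_coeff_mult)
      also have "Polynomial.lead_coeff m = Polynomial.lead_coeff s"
        using \<open>s \<noteq> 0\<close> by (simp add: m_def Polynomial.degree_monom_eq)
      finally have "Polynomial.coeff r (Polynomial.degree s) = 0"
        by (simp add: r_def)
      moreover have "Polynomial.degree r \<le> Polynomial.degree s"
        unfolding r_def using mh by (intro Polynomial.degree_diff_le) auto
      ultimately have "Polynomial.degree r < Polynomial.degree s"
        using False by (metis le_neq_implies_less Polynomial.leading_coeff_0_iff)
      then show ?thesis using less.hyps r by blast
    qed
    then obtain q where q: "q \<in> polys" "r = h' * q" by blast
    have "Polynomial.smult ?l s = h' * (q + Polynomial.smult c m)"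
      using q(2) h(3) by (simp add: r_def algebra_simps)
    moreover have "q + Polynomial.smult c m \<in> polys"
      using q m h(4) by (intro polys_add polys_smult)
    ultimately show ?thesis by blast
  qed
  then obtain q where q: "q \<in> polys" "Polynomial.smult ?l s = h' * q" by blast
  have l: "?l \<noteq> 0" using h(2) by simp
  have s: "s = Polynomial.smult (1 / ?l) (h' * q)"
    using l by (simp flip: q(2))
  then have "Polynomial.smult (1 / ?l) q \<in> polys"
    using gauss[OF h(5) q(1)] sp by simp
  moreover have "s = h' * Polynomial.smult (1 / ?l) q"
    using s by simp
  ultimately show ?case by blast
qed


text \<open>The gcd splits into a polynomial part and a scalar part: a primitive polynomial
  \<open>h'\<close> from an element of least degree, and the content \<open>g\<close> of what is
  left after division by \<open>h'\<close>.\<close>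

theorem complete_gcd_laurent_ext:
  assumes "x \<noteq> 0" and transcendental: "\<And>p. p \<in> polys \<Longrightarrow> Polynomial.poly p x = 0 \<Longrightarrow> p = 0"
  shows "complete_gcd_ring (laurent_ext x)"
proof -
  interpret L: subring_of_field "laurent_ext x"
    using assms(1) by (rule subring_laurent_ext)
  let ?L = "laurent_ext x"
  have "\<exists>g. g \<noteq> 0 \<and> (\<forall>y. (\<forall>s\<in>S. y * s \<in> ?L) \<longleftrightarrow> y * g \<in> ?L)"
    if S: "S \<subseteq> ?L" "\<not> S \<subseteq> {0}" for S
  proof -
    \<comment> \<open>\<open>T\<close> is the colon of \<open>S\<close>, and \<open>I\<close> is the
      double colon contracted to polynomials: an ideal that has the same colon as
      \<open>S\<close>.\<close>
    define T where "T = {y. \<forall>s\<in>S. y * s \<in> ?L}"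
    define I where "I = {p\<in>polys. \<forall>y\<in>T. y * Polynomial.poly p x \<in> ?L}"
    have SI: "\<exists>p m. p \<in> I \<and> s = Polynomial.poly p x / x ^ m" if "s \<in> S" for s
    proof -
      have "s \<in> ?L"
        using S(1) that by blast
      then obtain p m where p: "p \<in> polys" "s = Polynomial.poly p x / x ^ m"
        by (auto simp: laurent_ext_def)
      have "x ^ m \<in> ?L"
        using laurent_extI'[OF polys_monom[OF one_mem], of m x] by (simp add: Polynomial.poly_monom)
      have "Polynomial.poly p x = x ^ m * s"
        using p(2) assms(1) by simp
      moreover have "y * (x ^ m * s) \<in> ?L" if "y \<in> T" for y
        using L.mult_mem[OF \<open>x ^ m \<in> ?L\<close>, of "y * s"] that \<open>s \<in> S\<close> by (simp add: T_def mult_ac)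
      ultimately have "p \<in> I"
        using p(1) by (simp add: I_def)
      with p(2) show ?thesis by blast
    qed
    have I1: "I \<subseteq> polys" "\<And>p q. p \<in> I \<Longrightarrow> q \<in> I \<Longrightarrow> p - q \<in> I"
      by (auto simp: I_def right_diff_distrib polys_diff L.diff_mem)
    have I2: "q * p \<in> I" if "p \<in> I" "q \<in> polys" for p q
    proof -
      have "y * (Polynomial.poly q x * Polynomial.poly p x) \<in> ?L" if "y \<in> T" for y
        using L.mult_mem[OF laurent_extI'[OF \<open>q \<in> polys\<close>], of "y * Polynomial.poly p x"] \<open>p \<in> I\<close> that
        by (simp add: I_def mult.left_commute)
      then show ?thesis
        using that by (simp add: I_def polys_mult)
    qed
    note I = I1 I2
    obtain s where "s \<in> S" "s \<noteq> 0"
      using S(2) by auto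
    then have "\<exists>p. p \<in> I \<and> p \<noteq> 0"
      using SI by fastforce
    then obtain h where h: "h \<in> I" "h \<noteq> 0"
      and min: "\<And>p. p \<in> I \<Longrightarrow> p \<noteq> 0 \<Longrightarrow> Polynomial.degree h \<le> Polynomial.degree p"
      using ex_has_least_nat[of "\<lambda>p. p \<in> I \<and> p \<noteq> 0" _ Polynomial.degree] by blast
    then obtain c h' where c: "c \<in> R" "c \<noteq> 0" "h = Polynomial.smult c h'" "primitive h'"
      using primitive_part[of h] I(1) by blast
    have h': "h' \<in> polys" "h' \<noteq> 0"
      using c(4) by (auto simp: primitive_def)
    have dvd: "\<exists>q\<in>polys. p = h' * q" if "p \<in> I" for p
      using primitive_dvd[OF I h c(3,1,4) min that] .
    \<comment> \<open>The cofactors of \<open>h'\<close>. The constant \<open>c\<close> is among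
      them, so \<open>z * c\<close> below is a Laurent polynomial and \<open>z\<close> has a scalar
      denominator.\<close>
    define J where "J = {q\<in>polys. h' * q \<in> I}"
    have "[:c:] \<in> J"
      using c h(1) by (auto simp: J_def intro: polys_const)
    then have "\<not> J \<subseteq> {0}"
      using c(2) by auto
    moreover have "J \<subseteq> polys"
      by (auto simp: J_def)
    ultimately obtain g where g: "g \<in> R" "g \<noteq> 0" "\<And>y. (\<forall>p\<in>J. Polynomial.smult y p \<in> polys) \<longleftrightarrow> y * g \<in> R"
      using ex_content by metis
    let ?G = "Polynomial.poly h' x * g"
    have "y * ?G \<in> ?L" if y: "\<forall>s\<in>S. y * s \<in> ?L" for y
    proof -
      define z where "z = y * Polynomial.poly h' x"
      have zJ: "z * Polynomial.poly q x \<in> ?L" if "q \<in> J" for q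
      proof -
        have "y \<in> T" using y by (simp add: T_def)
        then have "y * Polynomial.poly (h' * q) x \<in> ?L"
          using that by (auto simp: J_def I_def)
        then show ?thesis by (simp add: z_def mult.assoc)
      qed
      from zJ[OF \<open>[:c:] \<in> J\<close>] obtain w m where w: "w \<in> polys" "z * c = Polynomial.poly w x / x ^ m"
        by (auto simp: laurent_ext_def)
      \<comment> \<open>That \<open>z\<close> times the value of \<open>q\<close> is a Laurent
        polynomial says that \<open>c\<close> divides \<open>w * q\<close> up to powers of
        \<open>x\<close>; comparing coefficients shifted by \<open>N\<close> removes these
        powers.\<close>
      have wJ: "Polynomial.smult (1 / c) (w * q) \<in> polys" if q: "q \<in> J" for q
      proof -
        obtain v N where v: "v \<in> polys" "z * Polynomial.poly q x = Polynomial.poly v x / x ^ N"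
          using zJ[OF q] by (auto simp: laurent_ext_def)
        have "c * (z * Polynomial.poly q x) * x ^ m * x ^ N = Polynomial.poly w x * Polynomial.poly q x * x ^ N"
          using w(2) assms(1) by (simp add: field_simps)
        then have "Polynomial.poly (w * q * Polynomial.monom 1 N - Polynomial.smult c (v * Polynomial.monom 1 m)) x = 0"
          using assms(1) v(2) by (simp add: Polynomial.poly_monom field_simps)
        moreover have "w * q * Polynomial.monom 1 N - Polynomial.smult c (v * Polynomial.monom 1 m) \<in> polys"
          using w(1) v(1) q c(1) one_mem
          by (auto simp: J_def intro!: polys_diff polys_mult polys_smult polys_monom)
        ultimately have "w * q * Polynomial.monom 1 N - Polynomial.smult c (v * Polynomial.monom 1 m) = 0"
          using transcendental by blast
        then have "Polynomial.monom 1 N * (w * q) = Polynomial.smult c (v * Polynomial.monom 1 m)"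
          by (simp add: mult.commute)
        then have "Polynomial.coeff (Polynomial.monom 1 N * (w * q)) (i + N) = c * Polynomial.coeff (v * Polynomial.monom 1 m) (i + N)" for i
          by simp
        then have "Polynomial.coeff (w * q) i = c * Polynomial.coeff (v * Polynomial.monom 1 m) (i + N)" for i
          unfolding Polynomial.coeff_monom_mult by simp
        then have "Polynomial.coeff (Polynomial.smult (1 / c) (w * q)) i = Polynomial.coeff (v * Polynomial.monom 1 m) (i + N)" for i
          using c(2) by simp
        moreover have "v * Polynomial.monom 1 m \<in> polys"
          using v(1) one_mem by (intro polys_mult polys_monom)
        ultimately show ?thesis
          by (simp add: polys_def)
      qed
      show ?thesis
      proof (cases "w = 0")
        case True
        then have "z = 0" using w c(2) by simp
        then have "y * ?G = 0" unfolding z_def by (metis mult.assoc mult_zero_left)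
        then show ?thesis using L.zero_mem by (simp only:)
      next
        case False
        then obtain b w' where b: "b \<in> R" "b \<noteq> 0" "w = Polynomial.smult b w'" "primitive w'"
          using primitive_part w(1) by blast
        \<comment> \<open>Gauss's lemma cancels the primitive part \<open>w'\<close> of
          \<open>w\<close>, after which the defining property of the content \<open>g\<close> of
          \<open>J\<close> applies to \<open>b / c\<close>.\<close>
        have "Polynomial.smult (b / c) q \<in> polys" if "q \<in> J" for q
          using wJ[OF that] gauss[OF b(4), of q "b / c"] that by (simp add: b(3) J_def)
        then have bg: "b / c * g \<in> R"
          using g(3) by blast
        have "y * ?G = Polynomial.poly (Polynomial.smult (b / c * g) w') x / x ^ m"
          using arg_cong[OF w(2), of "\<lambda>t. t * g / c"] c(2) by (simp add: z_def b(3) mult_ac)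
        also have "\<dots> \<in> ?L"
          using bg b(4) by (intro laurent_extI polys_smult) (auto simp: primitive_def)
        finally show ?thesis .
      qed
    qed
    moreover have "y * s \<in> ?L" if y: "y * ?G \<in> ?L" and s: "s \<in> S" for y s
    proof -
      obtain p m where p: "p \<in> I" "s = Polynomial.poly p x / x ^ m"
        using SI s by blast
      then obtain q where q: "q \<in> polys" "p = h' * q"
        using dvd by blast
      then have "q \<in> J"
        using p(1) by (simp add: J_def)
      then have "Polynomial.smult (1 / g) q \<in> polys"
        using g(2) g(3)[of "1 / g"] one_mem by simp
      then have "y * ?G * (Polynomial.poly (Polynomial.smult (1 / g) q) x / x ^ m) \<in> ?L"
        by (rule L.mult_mem[OF y laurent_extI])
      also have "y * ?G * (Polynomial.poly (Polynomial.smult (1 / g) q) x / x ^ m) = y * s"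
        using g(2) by (simp add: p(2) q(2))
      finally show ?thesis .
    qed
    moreover have "?G \<noteq> 0"
      using h' g(2) transcendental[of h'] by auto
    ultimately show ?thesis by blast
  qed
  then show ?thesis
    by unfold_locales blast
qed

end

section \<open>Subrings spanned by monomials\<close>

lemma poly_mapping_sum_single: "p = (\<Sum>u\<in>Poly_Mapping.keys p. Poly_Mapping.single u (Poly_Mapping.lookup p u))"
proof (rule poly_mapping_eqI)
  fix v
  show "Poly_Mapping.lookup p v = Poly_Mapping.lookup (\<Sum>u\<in>Poly_Mapping.keys p. Poly_Mapping.single u (Poly_Mapping.lookup p u)) v"
    by (simp add: Poly_Mapping.lookup_sum Poly_Mapping.lookup_single when_def sum.delta in_keys_iff)
qed

lemma lookup_mult_single:
  fixes p :: "'g::ab_group_add \<Rightarrow>\<^sub>0 'k::comm_ring_1"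
  shows "Poly_Mapping.lookup (p * Poly_Mapping.single w 1) v = Poly_Mapping.lookup p (v - w)"
proof -
  have "p * Poly_Mapping.single w 1 = (\<Sum>u\<in>Poly_Mapping.keys p. Poly_Mapping.single (u + w) (Poly_Mapping.lookup p u))"
    by (subst poly_mapping_sum_single[of p]) (simp add: sum_distrib_right Poly_Mapping.mult_single)
  also have "Poly_Mapping.lookup \<dots> v = (\<Sum>u\<in>Poly_Mapping.keys p. if u = v - w then Poly_Mapping.lookup p u else 0)"
    unfolding Poly_Mapping.lookup_sum by (rule sum.cong) (auto simp: Poly_Mapping.lookup_single when_def)
  finally show ?thesis
    by (simp add: sum.delta in_keys_iff)
qed

text \<open>A copy of the group algebra of \<open>'g\<close> over \<open>'k\<close> inside a field;
  \<open>independent\<close> makes it faithful, which gives its elements a well-defined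
  support.\<close>

locale laurent_monomials =
  fixes mon :: "'g::ab_group_add \<Rightarrow> 'f::field" and emb :: "'k::field \<Rightarrow> 'f"
  assumes mon_zero: "mon 0 = 1" and mon_add: "mon (u + v) = mon u * mon v"
    and emb_zero: "emb 0 = 0" and emb_one: "emb 1 = 1"
    and emb_add: "emb (a + b) = emb a + emb b" and emb_mult: "emb (a * b) = emb a * emb b"
    and independent: "\<And>p. (\<Sum>u\<in>Poly_Mapping.keys p. emb (Poly_Mapping.lookup p u) * mon u) = 0 \<Longrightarrow> p = 0"
begin

lemma mon_minus: "mon (- u) = inverse (mon u)"
  using mon_add[of u "- u"] mon_zero by (simp add: inverse_unique)

lemma mon_nonzero: "mon u \<noteq> 0"
  using mon_add[of u "- u"] mon_zero by auto

lemma mon_minus_mult: "mon (- u) * mon u = 1" "mon u * mon (- u) = 1"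
  by (simp_all add: mon_minus mon_nonzero)

section \<open>Evaluation, spans of monomials and supports\<close>

definition eval :: "('g \<Rightarrow>\<^sub>0 'k) \<Rightarrow> 'f" where
  "eval p = (\<Sum>u\<in>Poly_Mapping.keys p. emb (Poly_Mapping.lookup p u) * mon u)"

lemma eval_superset:
  assumes "finite U" "Poly_Mapping.keys p \<subseteq> U"
  shows "eval p = (\<Sum>u\<in>U. emb (Poly_Mapping.lookup p u) * mon u)"
  unfolding eval_def using assms
  by (intro sum.mono_neutral_left) (auto simp: in_keys_iff emb_zero)

lemma eval_add: "eval (p + q) = eval p + eval q"
proof -
  let ?U = "Poly_Mapping.keys p \<union> Poly_Mapping.keys q"
  have "eval (p + q) = (\<Sum>u\<in>?U. emb (Poly_Mapping.lookup (p + q) u) * mon u)"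
    by (rule eval_superset) (auto simp: Poly_Mapping.keys_add)
  also have "\<dots> = (\<Sum>u\<in>?U. emb (Poly_Mapping.lookup p u) * mon u) + (\<Sum>u\<in>?U. emb (Poly_Mapping.lookup q u) * mon u)"
    by (simp add: Poly_Mapping.lookup_add emb_add distrib_right sum.distrib)
  also have "\<dots> = eval p + eval q"
    by (simp add: eval_superset[of ?U])
  finally show ?thesis .
qed

lemma eval_zero: "eval 0 = 0"
  by (simp add: eval_def)

lemma eval_diff: "eval (p - q) = eval p - eval q"
  using eval_add[of "p - q" q] by (simp add: algebra_simps)

lemma eval_sum: "eval (sum f A) = (\<Sum>i\<in>A. eval (f i))"
  by (induction A rule: infinite_finite_induct) (auto simp: eval_zero eval_add)

lemma eval_single: "eval (Poly_Mapping.single u c) = emb c * mon u"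
  by (cases "c = 0") (simp_all add: eval_def emb_zero)

lemma eval_mult: "eval (p * q) = eval p * eval q"
proof -
  have "p * q = (\<Sum>u\<in>Poly_Mapping.keys p. \<Sum>v\<in>Poly_Mapping.keys q.
      Poly_Mapping.single (u + v) (Poly_Mapping.lookup p u * Poly_Mapping.lookup q v))"
    by (subst poly_mapping_sum_single[of p], subst poly_mapping_sum_single[of q])
      (simp add: sum_product Poly_Mapping.mult_single)
  then show ?thesis
    by (simp add: eval_sum eval_single mon_add emb_mult) (simp add: eval_def sum_product mult_ac)
qed

lemma eval_inject: "eval p = eval q \<longleftrightarrow> p = q"
proof
  assume "eval p = eval q"
  then have "eval (p - q) = 0"
    by (simp add: eval_diff)
  then show "p = q"
    using independent[of "p - q"] by (simp add: eval_def)
qed simp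

lemma eval_eq_0_iff: "eval p = 0 \<longleftrightarrow> p = 0"
  using eval_inject[of p 0] by (simp add: eval_zero)

definition monomial_span :: "'g set \<Rightarrow> 'f set" where
  "monomial_span H = eval ` {p. Poly_Mapping.keys p \<subseteq> H}"

text \<open>Meaningful only on the range of \<open>eval\<close>, since \<open>inv_into\<close> is
  arbitrary elsewhere; hence the recurring side condition of membership in
  \<open>monomial_span UNIV\<close>.\<close>

definition supp :: "'f \<Rightarrow> 'g set" where
  "supp a = Poly_Mapping.keys (inv_into UNIV eval a)"

lemma supp_eval: "supp (eval p) = Poly_Mapping.keys p"
  by (simp add: supp_def inv_f_f inj_def eval_inject)

lemma span_iff: "a \<in> monomial_span H \<longleftrightarrow> a \<in> monomial_span UNIV \<and> supp a \<subseteq> H"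
  by (auto simp: monomial_span_def supp_eval)

lemma span_suppD: "a \<in> monomial_span H \<Longrightarrow> u \<in> supp a \<Longrightarrow> u \<in> H"
  by (auto simp: monomial_span_def supp_eval)

lemma span_UNIV: "a \<in> monomial_span H \<Longrightarrow> a \<in> monomial_span UNIV"
  by (auto simp: monomial_span_def)

lemma spanI: "a \<in> monomial_span UNIV \<Longrightarrow> (\<And>u. u \<in> supp a \<Longrightarrow> u \<in> H) \<Longrightarrow> a \<in> monomial_span H"
  by (auto simp: monomial_span_def supp_eval)

lemma span_mono: "H \<subseteq> H' \<Longrightarrow> monomial_span H \<subseteq> monomial_span H'"
  by (auto simp: monomial_span_def)

lemma finite_supp: "finite (supp a)"
  by (simp add: supp_def)

lemma supp_nonempty: "a \<in> monomial_span UNIV \<Longrightarrow> a \<noteq> 0 \<Longrightarrow> supp a \<noteq> {}"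
  by (auto simp: monomial_span_def supp_eval eval_zero)

lemma span_emb_mon: "u \<in> H \<Longrightarrow> emb c * mon u \<in> monomial_span H"
  unfolding monomial_span_def by (rule image_eqI[of _ _ "Poly_Mapping.single u c"]) (auto simp: eval_single)

lemma span_mon: "u \<in> H \<Longrightarrow> mon u \<in> monomial_span H"
  using span_emb_mon[of u H 1] by (simp add: emb_one)

lemma supp_mon: "supp (emb c * mon u) = (if c = 0 then {} else {u})"
  using supp_eval[of "Poly_Mapping.single u c"] by (simp add: eval_single)

lemma span_zero: "0 \<in> monomial_span H"
  unfolding monomial_span_def by (rule image_eqI[of _ _ 0]) (auto simp: eval_zero)

lemma span_add: "a \<in> monomial_span H \<Longrightarrow> b \<in> monomial_span H \<Longrightarrow> a + b \<in> monomial_span H"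
  unfolding monomial_span_def by (auto simp flip: eval_add dest!: subsetD[OF Poly_Mapping.keys_add])

lemma span_mult:
  assumes "a \<in> monomial_span H" "b \<in> monomial_span H'" "\<And>u v. u \<in> H \<Longrightarrow> v \<in> H' \<Longrightarrow> u + v \<in> H''"
  shows "a * b \<in> monomial_span H''"
proof -
  obtain p q where "a = eval p" "b = eval q" "Poly_Mapping.keys p \<subseteq> H" "Poly_Mapping.keys q \<subseteq> H'"
    using assms by (auto simp: monomial_span_def)
  moreover from this have "Poly_Mapping.keys (p * q) \<subseteq> H''"
    using Poly_Mapping.keys_mult[of p q] assms(3) by blast
  ultimately show ?thesis
    by (auto simp: monomial_span_def simp flip: eval_mult)
qed

lemma span_emb_mult: "a \<in> monomial_span H \<Longrightarrow> emb c * a \<in> monomial_span H"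
  using span_mult[OF span_emb_mon[of 0 "{0}" c], of a H H] by (simp add: mon_zero)

lemma span_diff: "a \<in> monomial_span H \<Longrightarrow> b \<in> monomial_span H \<Longrightarrow> a - b \<in> monomial_span H"
  using span_add[of a H "emb (- 1) * b"] span_emb_mult[of b H "- 1"] emb_add[of 1 "- 1"] emb_one emb_zero
  by (simp add: add_eq_0_iff)

lemma span_sum: "(\<And>i. i \<in> A \<Longrightarrow> f i \<in> monomial_span H) \<Longrightarrow> sum f A \<in> monomial_span H"
  by (induction A rule: infinite_finite_induct) (auto intro: span_zero span_add)

lemma span_expand:
  assumes "a \<in> monomial_span H"
  obtains c where "a = (\<Sum>u\<in>supp a. emb (c u) * mon u)" "supp a \<subseteq> H"
proof -
  obtain p where "a = eval p" "Poly_Mapping.keys p \<subseteq> H"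
    using assms by (auto simp: monomial_span_def)
  then show thesis
    using that[of "Poly_Mapping.lookup p"] by (simp only: supp_eval eval_def[of p, symmetric])
qed

lemma span_shift: "mon w * a \<in> monomial_span H \<longleftrightarrow> a \<in> monomial_span {u. w + u \<in> H}"
proof
  assume "mon w * a \<in> monomial_span H"
  then have "mon (- w) * (mon w * a) \<in> monomial_span {u. w + u \<in> H}"
    by (intro span_mult[OF span_mon[of "- w" "{- w}"]]) auto
  then show "a \<in> monomial_span {u. w + u \<in> H}"
    by (simp add: mon_minus_mult flip: mult.assoc)
qed (auto intro: span_mult[OF span_mon[of w "{w}"]])

lemma subring_span:
  assumes "0 \<in> H" "\<And>u v. u \<in> H \<Longrightarrow> v \<in> H \<Longrightarrow> u + v \<in> H"
  shows "subring_of_field (monomial_span H)"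
  using assms span_mon[of 0 H] by unfold_locales (auto simp: mon_zero intro: span_diff span_mult)

text \<open>The monomial valuation given by \<open>\<sigma>\<close>, for Laurent polynomials. At
  \<open>0\<close> it is the minimum of the empty set, an unspecified value.\<close>

definition order_of :: "('g \<Rightarrow> int) \<Rightarrow> 'f \<Rightarrow> int" where
  "order_of \<sigma> a = Min (\<sigma> ` supp a)"

lemma order_of_le: "u \<in> supp a \<Longrightarrow> order_of \<sigma> a \<le> \<sigma> u"
  unfolding order_of_def by (intro Min_le) (auto simp: finite_supp)

lemma order_of_ge_iff: "a \<in> monomial_span UNIV \<Longrightarrow> a \<noteq> 0 \<Longrightarrow> n \<le> order_of \<sigma> a \<longleftrightarrow> (\<forall>u\<in>supp a. n \<le> \<sigma> u)"
  unfolding order_of_def using supp_nonempty finite_supp by (subst Min_ge_iff) auto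

lemma initial_form:
  assumes "a \<in> monomial_span UNIV" "a \<noteq> 0"
  obtains b c where "a = b + c" "b \<in> monomial_span {u. \<sigma> u = order_of \<sigma> a}" "b \<noteq> 0"
    "c \<in> monomial_span {u. \<sigma> u > order_of \<sigma> a}"
proof -
  let ?S = "{u. \<sigma> u = order_of \<sigma> a}"
  obtain p where p: "a = eval p"
    using assms(1) by (auto simp: monomial_span_def)
  define q where "q = (\<Sum>u\<in>Poly_Mapping.keys p \<inter> ?S. Poly_Mapping.single u (Poly_Mapping.lookup p u))"
  have q: "Poly_Mapping.lookup q u = (if \<sigma> u = order_of \<sigma> a then Poly_Mapping.lookup p u else 0)" for u
    unfolding q_def Poly_Mapping.lookup_sum
    by (simp add: Poly_Mapping.lookup_single when_def sum.delta) (auto simp: in_keys_iff)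
  have "order_of \<sigma> a \<in> \<sigma> ` supp a"
    unfolding order_of_def using finite_supp supp_nonempty[OF assms] by (intro Min_in) auto
  then obtain v where "\<sigma> v = order_of \<sigma> a" "v \<in> Poly_Mapping.keys p"
    by (auto simp: p supp_eval)
  then have "q \<noteq> 0"
    using q[of v] by (auto simp: in_keys_iff)
  moreover have "Poly_Mapping.keys (p - q) \<subseteq> {u. \<sigma> u > order_of \<sigma> a}"
  proof
    fix u assume "u \<in> Poly_Mapping.keys (p - q)"
    then have "u \<in> Poly_Mapping.keys p" "\<sigma> u \<noteq> order_of \<sigma> a"
      by (auto simp: in_keys_iff Poly_Mapping.lookup_minus q split: if_splits)
    then show "u \<in> {u. \<sigma> u > order_of \<sigma> a}"
      using order_of_le[of u a \<sigma>] by (simp add: p supp_eval)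
  qed
  moreover have "Poly_Mapping.keys q \<subseteq> ?S"
    by (auto simp: in_keys_iff q split: if_splits)
  ultimately show thesis
    using that[of "eval q" "eval (p - q)"] eval_add[of q "p - q"]
    unfolding monomial_span_def by (simp add: p eval_eq_0_iff)
qed

text \<open>The parts of lowest \<open>\<sigma>\<close>-degree multiply to a nonzero element.\<close>

lemma order_of_mult:
  assumes \<sigma>: "\<And>u v. \<sigma> (u + v) = \<sigma> u + \<sigma> v"
    and a: "a \<in> monomial_span UNIV" "a \<noteq> 0" and b: "b \<in> monomial_span UNIV" "b \<noteq> 0"
  shows "order_of \<sigma> (a * b) = order_of \<sigma> a + order_of \<sigma> b"
proof -
  let ?n = "order_of \<sigma> a + order_of \<sigma> b"
  obtain a0 a1 where a': "a = a0 + a1" "a0 \<in> monomial_span {u. \<sigma> u = order_of \<sigma> a}" "a0 \<noteq> 0"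
    "a1 \<in> monomial_span {u. \<sigma> u > order_of \<sigma> a}"
    using initial_form[OF a] .
  obtain b0 b1 where b': "b = b0 + b1" "b0 \<in> monomial_span {u. \<sigma> u = order_of \<sigma> b}" "b0 \<noteq> 0"
    "b1 \<in> monomial_span {u. \<sigma> u > order_of \<sigma> b}"
    using initial_form[OF b] .
  have 0: "a0 * b0 \<in> monomial_span {u. \<sigma> u = ?n}"
    using a'(2) b'(2) by (rule span_mult) (simp add: \<sigma>)
  have "a0 * b1 + a1 * b \<in> monomial_span {u. \<sigma> u > ?n}"
  proof (rule span_add)
    show "a0 * b1 \<in> monomial_span {u. \<sigma> u > ?n}"
      using a'(2) b'(4) by (rule span_mult) (simp add: \<sigma>)
    have "b \<in> monomial_span (supp b)"
      using b(1) by (rule spanI)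
    with a'(4) show "a1 * b \<in> monomial_span {u. \<sigma> u > ?n}"
      by (rule span_mult) (use order_of_le[of _ b \<sigma>] in \<open>force simp: \<sigma>\<close>)
  qed
  moreover define r where "r = a0 * b1 + a1 * b"
  ultimately have r: "r \<in> monomial_span {u. \<sigma> u > ?n}" by simp
  have ab: "a * b = a0 * b0 + r"
    by (simp add: r_def a'(1) b'(1) algebra_simps)
  have U: "a * b \<in> monomial_span UNIV"
    using a(1) b(1) by (rule span_mult) simp
  have "?n \<le> order_of \<sigma> (a * b)"
  proof -
    have "a * b \<in> monomial_span {u. ?n \<le> \<sigma> u}"
      unfolding ab by (rule span_add[OF subsetD[OF span_mono 0] subsetD[OF span_mono r]]) auto
    then have "\<forall>u\<in>supp (a * b). ?n \<le> \<sigma> u"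
      by (auto dest: span_suppD)
    then show ?thesis
      using a(2) b(2) U by (simp add: order_of_ge_iff)
  qed
  \<comment> \<open>Otherwise \<open>a0 * b0\<close> would be supported both in degree
    \<open>?n\<close> and strictly above it, hence be zero, although it is a product of nonzero
    elements of a field.\<close>
  moreover have "\<not> ?n < order_of \<sigma> (a * b)"
  proof
    assume "?n < order_of \<sigma> (a * b)"
    then have "?n < \<sigma> u" if "u \<in> supp (a * b)" for u
      using order_of_le[OF that, of \<sigma>] by simp
    then have "a * b \<in> monomial_span {u. \<sigma> u > ?n}"
      by (intro spanI[OF U]) simp
    then have "a * b - r \<in> monomial_span {u. \<sigma> u > ?n}"
      using r by (rule span_diff)
    then have "a0 * b0 \<in> monomial_span {u. \<sigma> u > ?n}"
      by (simp add: ab)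
    moreover obtain u where "u \<in> supp (a0 * b0)"
      using supp_nonempty[OF span_UNIV[OF 0]] a'(3) b'(3) by auto
    ultimately show False
      using span_suppD[OF 0] span_suppD[of "a0 * b0"] by fastforce
  qed
  ultimately show ?thesis by simp
qed

text \<open>The scalars form a field, so every nonzero set has gcd one; this starts the adjunction
  of variables.\<close>

lemma complete_gcd_scalars: "complete_gcd_ring (monomial_span {0})"
proof -
  interpret subring_of_field "monomial_span {0}"
    by (rule subring_span) auto
  have inv: "1 / s \<in> monomial_span {0}" if s: "s \<in> monomial_span {0}" "s \<noteq> 0" for s
  proof -
    obtain c where c: "s = (\<Sum>u\<in>supp s. emb (c u) * mon u)" "supp s \<subseteq> {0}"
      using span_expand[OF s(1)] by blast
    then have "supp s = {0}"
      using s(2) by (metis sum.empty subset_singletonD)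
    then have "s = emb (c 0)"
      using c(1) by (simp add: mon_zero)
    moreover from this have "c 0 \<noteq> 0"
      using s(2) emb_zero by auto
    ultimately have "s * emb (1 / c 0) = 1"
      using emb_mult[of "c 0" "1 / c 0"] emb_one by simp
    then have "1 / s = emb (1 / c 0)"
      using s(2) by (simp add: field_simps)
    then show ?thesis
      using span_emb_mon[of 0 "{0}" "1 / c 0"] by (simp add: mon_zero)
  qed
  show ?thesis
  proof
    fix S assume S: "S \<subseteq> monomial_span {0}" "\<not> S \<subseteq> {0}"
    then obtain s where s: "s \<in> S" "s \<noteq> 0" by blast
    have "y \<in> monomial_span {0}" if "\<forall>s\<in>S. y * s \<in> monomial_span {0}" for y
    proof -
      have "y * s * (1 / s) \<in> monomial_span {0}"
        using that s S(1) by (blast intro: mult_mem inv)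
      then show ?thesis using s(2) by simp
    qed
    then show "\<exists>g. g \<noteq> 0 \<and> (\<forall>y. (\<forall>s\<in>S. y * s \<in> monomial_span {0}) \<longleftrightarrow> y * g \<in> monomial_span {0})"
      using S(1) by (intro exI[of _ 1]) (auto intro: mult_mem)
  qed
qed

text \<open>Adjoins one Laurent variable \<open>mon (z 1)\<close>. The nonzero multiples of
  \<open>z 1\<close> avoid the subgroup \<open>H\<close>, so the cosets \<open>H + z i\<close> are
  disjoint, which makes the variable transcendental over the old ring.\<close>

lemma complete_gcd_adjoin:
  fixes z :: "int \<Rightarrow> 'g"
  assumes gcd: "complete_gcd_ring (monomial_span H)"
    and H: "0 \<in> H" "\<And>u v. u \<in> H \<Longrightarrow> v \<in> H \<Longrightarrow> u - v \<in> H"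
    and z: "\<And>i j. z (i + j) = z i + z j" "\<And>i. z i \<in> H \<Longrightarrow> i = 0"
  shows "complete_gcd_ring (monomial_span {h + z i | h i. h \<in> H})"
proof -
  interpret R: complete_gcd_ring "monomial_span H" by (rule gcd)
  have Hadd: "u + v \<in> H" if "u \<in> H" "v \<in> H" for u v
    using H(2)[OF that(1) H(2)[OF H(1) that(2)]] by simp
  have z0: "z 0 = 0"
    using z(1)[of 0 0] by simp
  have zdiff: "z (i - j) = z i - z j" for i j
    using z(1)[of "i - j" j] by (simp add: algebra_simps)
  let ?x = "mon (z 1)"
  let ?H = "{h + z i | h i. h \<in> H}"
  have xpow: "?x ^ n = mon (z (int n))" for n
    by (induction n) (simp_all add: z0 mon_zero z(1) mon_add)
  have Hz: "u + v \<in> ?H" if uv: "u \<in> ?H" "v \<in> ?H" for u v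
  proof -
    obtain h i h' j where "u = h + z i" "v = h' + z j" "h \<in> H" "h' \<in> H"
      using uv by blast
    then have "u + v = (h + h') + z (i + j)" "h + h' \<in> H"
      using Hadd by (auto simp: z(1))
    then show ?thesis by blast
  qed
  have zH: "z i \<in> ?H" for i
    using H(1) by force
  have HH: "H \<subseteq> ?H"
    using z0 by force
  have "0 \<in> ?H"
    using HH H(1) by blast
  then interpret L: subring_of_field "monomial_span ?H"
    using Hz by (rule subring_span)
  interpret L': subring_of_field "R.laurent_ext ?x"
    using mon_nonzero by (rule R.subring_laurent_ext)
  have "complete_gcd_ring (R.laurent_ext ?x)"
  proof (rule R.complete_gcd_laurent_ext[OF mon_nonzero])
    fix p assume p: "p \<in> R.polys" "Polynomial.poly p ?x = 0"
    have "\<forall>i. \<exists>q. Polynomial.coeff p i = eval q \<and> Poly_Mapping.keys q \<subseteq> H"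
      using R.coeff_mem[OF p(1)] by (force simp: monomial_span_def)
    then obtain q where q: "\<And>i. Polynomial.coeff p i = eval (q i)" "\<And>i. Poly_Mapping.keys (q i) \<subseteq> H"
      by metis
    define r where "r = (\<Sum>i\<le>Polynomial.degree p. q i * Poly_Mapping.single (z (int i)) 1)"
    have "eval r = 0"
      using p(2) by (simp add: r_def eval_sum eval_mult eval_single emb_one Polynomial.poly_altdef q xpow)
    then have "r = 0"
      by (simp add: eval_eq_0_iff)
    have "q j = 0" if j: "j \<le> Polynomial.degree p" for j
    proof (rule ccontr)
      assume "q j \<noteq> 0"
      then obtain h where h: "h \<in> Poly_Mapping.keys (q j)"
        by (metis Poly_Mapping.keys_eq_empty ex_in_conv)
      \<comment> \<open>Only the term \<open>i = j\<close> contributes to the coset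
        \<open>H + z j\<close>, so a nonzero coefficient of \<open>q j\<close> survives in
        \<open>r\<close>, the value of \<open>p\<close> in the group algebra.\<close>
      have "Poly_Mapping.lookup (q i) (h + z (int j) - z (int i)) = (if i = j then Poly_Mapping.lookup (q j) h else 0)" for i
      proof (cases "i = j")
        case False
        have "h + z (int j) - z (int i) \<notin> H"
        proof
          assume "h + z (int j) - z (int i) \<in> H"
          then have "h + z (int j) - z (int i) - h \<in> H"
            by (rule H(2)[OF _ subsetD[OF q(2) h]])
          then have "z (int j - int i) \<in> H"
            by (simp add: zdiff algebra_simps)
          then show False
            using z(2) False by fastforce
        qed
        then show ?thesis
          using q(2)[of i] False by (auto simp: in_keys_iff)
      qed simp
      then have "Poly_Mapping.lookup r (h + z (int j)) = Poly_Mapping.lookup (q j) h"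
        using j by (simp add: r_def Poly_Mapping.lookup_sum lookup_mult_single sum.delta)
      then show False
        using h \<open>r = 0\<close> by (simp add: in_keys_iff)
    qed
    then have "Polynomial.coeff p (Polynomial.degree p) = 0"
      by (simp add: q eval_zero)
    then show "p = 0" by simp
  qed
  also have "R.laurent_ext ?x = monomial_span ?H"
  proof (intro equalityI subsetI)
    fix a assume "a \<in> R.laurent_ext ?x"
    then obtain p m where p: "p \<in> R.polys" "a = Polynomial.poly p ?x / ?x ^ m"
      by (auto simp: R.laurent_ext_def)
    have x: "mon (z i) \<in> monomial_span ?H" for i
      using zH by (rule span_mon)
    have "a = (\<Sum>i\<le>Polynomial.degree p. Polynomial.coeff p i * mon (z (int i))) * mon (z (- int m))"
      using zdiff[of 0 "int m"]
      by (simp add: p(2) Polynomial.poly_altdef xpow mon_minus z0 divide_inverse)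
    also have "\<dots> \<in> monomial_span ?H"
      using R.coeff_mem[OF p(1)] span_mono[OF HH] x by (intro L.mult_mem L.sum_mem) blast+
    finally show "a \<in> monomial_span ?H" .
  next
    fix a assume "a \<in> monomial_span ?H"
    then obtain c where c: "a = (\<Sum>u\<in>supp a. emb (c u) * mon u)" "supp a \<subseteq> ?H"
      using span_expand by blast
    have "emb (c u) * mon u \<in> R.laurent_ext ?x" if uS: "u \<in> supp a" for u
    proof -
      obtain h i where u: "u = h + z i" "h \<in> H"
        using subsetD[OF c(2) uS] by blast
      have e: "emb (c u) * mon h \<in> monomial_span H"
        using u(2) by (rule span_emb_mon)
      have "z i = z (int (nat i)) - z (int (nat (- i)))"
        unfolding zdiff[symmetric] by (rule arg_cong[of _ _ z]) simp
      then have "mon (z i) = ?x ^ nat i / ?x ^ nat (- i)"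
        using mon_add[of "z (int (nat i))" "- z (int (nat (- i)))"] by (simp add: xpow mon_minus divide_inverse)
      then have "emb (c u) * mon u = Polynomial.poly (Polynomial.monom (emb (c u) * mon h) (nat i)) ?x / ?x ^ nat (- i)"
        by (simp add: u mon_add Polynomial.poly_monom)
      also have "\<dots> \<in> R.laurent_ext ?x"
        using e by (intro R.laurent_extI R.polys_monom)
      finally show ?thesis .
    qed
    then show "a \<in> R.laurent_ext ?x"
      by (subst c(1)) (rule L'.sum_mem)
  qed
  finally show ?thesis .
qed

end

section \<open>Divisorial ideals of a normal toric ring\<close>

lemma torsion_free_of_iso_product_integers:
  assumes G: "group G" and iso: "G \<cong> product_group J (\<lambda>_. integer_group)"
  shows "torsion_free G"
  unfolding torsion_free_def
proof (intro ballI allI impI)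
  fix x and m :: nat
  assume x: "x \<in> carrier G" "0 < m" "x [^]\<^bsub>G\<^esub> m = \<one>\<^bsub>G\<^esub>"
  let ?Z = "product_group J (\<lambda>_. integer_group)"
  obtain h where h: "h \<in> iso G ?Z"
    using iso by (auto simp: is_iso_def)
  have Z: "group ?Z"
    by simp
  interpret h: group_hom G ?Z h
    using h G Z by (simp add: group_hom_def group_hom_axioms_def iso_def)
  have pow: "(y [^]\<^bsub>?Z\<^esub> k) j = int k * y j" if "j \<in> J" for y j and k :: nat
    using that by (induction k) (auto simp: algebra_simps)
  have hx: "h x \<in> carrier ?Z"
    using x(1) by (rule h.hom_closed)
  have "h x [^]\<^bsub>?Z\<^esub> m = \<one>\<^bsub>?Z\<^esub>"
    using h.hom_nat_pow[OF x(1), of m] x(3) h.hom_one by simp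
  then have "h x j = 0" if "j \<in> J" for j
    using pow[OF that, of "h x" m] x(2) that by simp
  then have "h x = (\<lambda>j\<in>J. 0)"
    using hx by (auto simp: PiE_def extensional_def fun_eq_iff)
  then have "h x = h \<one>\<^bsub>G\<^esub>"
    using h.hom_one by simp
  moreover have "inj_on h (carrier G)"
    using h by (simp add: iso_def bij_betw_def)
  ultimately show "x = \<one>\<^bsub>G\<^esub>"
    using x(1) h.G.one_closed by (meson inj_onD)
qed

text \<open>
  \<open>\<sigma> i\<close> for \<open>i \<in> \<Phi>\<close> are the facet functionals of a cone of full dimension. The assumption
  \<open>facet\<close> says that no facet inequality is redundant and that each \<open>\<sigma> i\<close> is primitive.
\<close>

locale normal_toric_ring = laurent_monomials mon emb
  for mon :: "'g::ab_group_add \<Rightarrow> 'f::field" and emb :: "'k::field \<Rightarrow> 'f" +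
  fixes \<Phi> :: "'i set" and \<sigma> :: "'i \<Rightarrow> 'g \<Rightarrow> int"
  assumes \<sigma>_add: "\<sigma> i (u + v) = \<sigma> i u + \<sigma> i v"
    and facet: "i \<in> \<Phi> \<Longrightarrow> \<exists>u. \<sigma> i u = n i \<and> (\<forall>j\<in>\<Phi>. n j \<le> \<sigma> j u)"
    and separating: "(\<And>i. i \<in> \<Phi> \<Longrightarrow> \<sigma> i u = 0) \<Longrightarrow> u = 0"
    and gcd_laurent: "complete_gcd_ring (monomial_span UNIV)"
    and fractions: "\<exists>a b. a \<in> monomial_span UNIV \<and> b \<in> monomial_span UNIV \<and> b \<noteq> 0 \<and> y = a / b"
begin

section \<open>Monomial ideals and their colons\<close>

lemma \<sigma>_zero: "\<sigma> i 0 = 0"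
  using \<sigma>_add[of i 0 0] by simp

lemma \<sigma>_diff: "\<sigma> i (u - v) = \<sigma> i u - \<sigma> i v"
  using \<sigma>_add[of i "u - v" v] by simp

text \<open>In monomial terms, the intersection of the symbolic powers of the facet primes with
  exponents \<open>n i\<close>; a negative exponent permits a pole along the facet.\<close>

definition D :: "('i \<Rightarrow> int) \<Rightarrow> 'f set" where
  "D n = monomial_span {u. \<forall>i\<in>\<Phi>. n i \<le> \<sigma> i u}"

abbreviation A :: "'f set" where
  "A \<equiv> D (\<lambda>_. 0)"

sublocale A: subring_of_field A
  unfolding D_def by (rule subring_span) (auto simp: \<sigma>_zero \<sigma>_add)

lemma D_cong: "(\<And>i. i \<in> \<Phi> \<Longrightarrow> n i = m i) \<Longrightarrow> D n = D m"
  unfolding D_def by (intro arg_cong[of _ _ monomial_span]) auto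

lemma ex_above: "\<exists>u. \<forall>i\<in>\<Phi>. n i \<le> \<sigma> i u"
  using facet[of _ n] by (cases "\<Phi> = {}") blast+

lemma D_UNIV: "a \<in> D n \<Longrightarrow> a \<in> monomial_span UNIV"
  unfolding D_def by (rule span_UNIV)

lemma D_zero: "0 \<in> D n"
  by (simp add: D_def span_zero)

lemma mon_D: "(\<And>i. i \<in> \<Phi> \<Longrightarrow> n i \<le> \<sigma> i u) \<Longrightarrow> mon u \<in> D n"
  unfolding D_def by (rule span_mon) simp

lemma D_nontrivial: "\<exists>a\<in>D n. a \<noteq> 0"
proof -
  obtain u where "\<forall>i\<in>\<Phi>. n i \<le> \<sigma> i u"
    using ex_above[of n] by blast
  then show ?thesis
    by (intro bexI[of _ "mon u"] mon_D mon_nonzero) simp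
qed

lemma D_iff: "a \<noteq> 0 \<Longrightarrow> a \<in> D n \<longleftrightarrow> a \<in> monomial_span UNIV \<and> (\<forall>i\<in>\<Phi>. n i \<le> order_of (\<sigma> i) a)"
  unfolding D_def by (subst span_iff) (auto simp: order_of_ge_iff subset_iff)

text \<open>Multipliers are tested on the monomials of \<open>D n\<close>. The bound at facet
  \<open>i\<close> is sharp because, by \<open>facet\<close>, some monomial of \<open>D n\<close>
  has exactly the value \<open>n i\<close> there.\<close>

lemma D_transporter: "(\<forall>x\<in>D n. y * x \<in> D m) \<longleftrightarrow> y \<in> D (\<lambda>i. m i - n i)"
proof
  assume y: "\<forall>x\<in>D n. y * x \<in> D m"
  have *: "y \<in> monomial_span {v. \<forall>i\<in>\<Phi>. m i \<le> \<sigma> i u + \<sigma> i v}" if "\<forall>i\<in>\<Phi>. n i \<le> \<sigma> i u" for u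
  proof -
    have "mon u * y \<in> monomial_span {u. \<forall>i\<in>\<Phi>. m i \<le> \<sigma> i u}"
      using y mon_D[of n u] that by (auto simp: mult.commute D_def)
    then show ?thesis
      by (simp add: span_shift \<sigma>_add)
  qed
  obtain u where "\<forall>i\<in>\<Phi>. n i \<le> \<sigma> i u"
    using ex_above[of n] by blast
  then have U: "y \<in> monomial_span UNIV"
    by (rule span_UNIV[OF *])
  have "m i - n i \<le> \<sigma> i v" if i: "i \<in> \<Phi>" and v: "v \<in> supp y" for i v
  proof -
    obtain u where u: "\<sigma> i u = n i" "\<forall>j\<in>\<Phi>. n j \<le> \<sigma> j u"
      using facet[OF i, of n] by blast
    show ?thesis
      using span_suppD[OF *[OF u(2)] v] i u(1) by fastforce
  qed
  then show "y \<in> D (\<lambda>i. m i - n i)"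
    unfolding D_def by (intro spanI[OF U]) simp
next
  assume "y \<in> D (\<lambda>i. m i - n i)"
  then show "\<forall>x\<in>D n. y * x \<in> D m"
    unfolding D_def by (intro ballI) (erule span_mult, assumption, fastforce simp: \<sigma>_add)
qed

text \<open>One monomial deep enough in the cone moves both numerator and denominator of a fraction
  of Laurent polynomials into \<open>A\<close>.\<close>

lemma frac_field_A: "frac_field A = UNIV"
proof -
  have "y \<in> frac_field A" for y
  proof -
    obtain a b where ab: "a \<in> monomial_span UNIV" "b \<in> monomial_span UNIV" "b \<noteq> 0" "y = a / b"
      using fractions[of y] by auto
    \<comment> \<open>For \<open>a = 0\<close> the order is an unspecified integer; this is
      harmless, since the support is then empty.\<close>
    obtain u where u: "\<forall>i\<in>\<Phi>. max (- order_of (\<sigma> i) a) (- order_of (\<sigma> i) b) \<le> \<sigma> i u"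
      using ex_above[of "\<lambda>i. max (- order_of (\<sigma> i) a) (- order_of (\<sigma> i) b)"] by blast
    have "mon u * c \<in> A" if c: "c \<in> monomial_span UNIV" "\<And>i. i \<in> \<Phi> \<Longrightarrow> - order_of (\<sigma> i) c \<le> \<sigma> i u" for c
      unfolding D_def span_shift
    proof (rule spanI[OF c(1)])
      fix v assume v: "v \<in> supp c"
      have "0 \<le> \<sigma> i u + \<sigma> i v" if "i \<in> \<Phi>" for i
        using order_of_le[OF v, of "\<sigma> i"] c(2)[OF that] by simp
      then show "v \<in> {v. u + v \<in> {u. \<forall>i\<in>\<Phi>. 0 \<le> \<sigma> i u}}"
        by (simp add: \<sigma>_add)
    qed
    note * = this
    have "mon u * a \<in> A"
      by (rule *[OF ab(1)]) (use u in simp)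
    moreover have "mon u * b \<in> A"
      by (rule *[OF ab(2)]) (use u in simp)
    moreover have "y = (mon u * a) / (mon u * b)"
      using ab(4) mon_nonzero by simp
    moreover have "mon u * b \<noteq> 0"
      using ab(3) mon_nonzero by simp
    ultimately show ?thesis
      unfolding frac_field_def by (intro CollectI exI[of _ "mon u * a"] exI[of _ "mon u * b"] conjI)
  qed
  then show ?thesis by (intro UNIV_eq_I[symmetric])
qed

lemma scaled_D_iff: "b \<noteq> 0 \<Longrightarrow> y \<in> (*) b ` D n \<longleftrightarrow> y / b \<in> D n"
  by (auto intro!: image_eqI[of y _ "y / b"])

lemma transporter_scaled:
  assumes "b \<noteq> 0"
  shows "colon A ((*) b ` D n) = (*) (1 / b) ` D (\<lambda>i. - n i)"
proof -
  have "y \<in> colon A ((*) b ` D n) \<longleftrightarrow> (\<forall>x\<in>D n. (y * b) * x \<in> A)" for y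
    by (auto simp: colon_def frac_field_A mult.assoc)
  also have "\<dots> y \<longleftrightarrow> y \<in> (*) (1 / b) ` D (\<lambda>i. - n i)" for y
    using assms scaled_D_iff[of "1 / b" y "\<lambda>i. - n i"] by (subst D_transporter) simp
  finally show ?thesis by blast
qed

text \<open>The colon of a product is an iterated colon, so \<open>D_transporter\<close> applies
  twice.\<close>

lemma colon_mult:
  assumes "b \<noteq> 0" "c \<noteq> 0"
  shows "colon A (ideal_mult ((*) b ` D n) ((*) c ` D m)) = (*) (1 / (b * c)) ` D (\<lambda>i. - (n i + m i))"
proof -
  let ?I = "(*) b ` D n" and ?J = "(*) c ` D m"
  have "(\<forall>z\<in>ideal_mult ?I ?J. y * z \<in> A) \<longleftrightarrow> (\<forall>x\<in>?I. \<forall>z\<in>?J. y * (x * z) \<in> A)" for y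
  proof (intro iffI ballI)
    fix x z assume *: "\<forall>z\<in>ideal_mult ?I ?J. y * z \<in> A" and "x \<in> ?I" "z \<in> ?J"
    then have "x * z \<in> ideal_mult ?I ?J"
      unfolding ideal_mult_def by (intro CollectI exI[of _ 1] exI[of _ "\<lambda>_. x"] exI[of _ "\<lambda>_. z"]) auto
    then show "y * (x * z) \<in> A"
      using * by blast
  next
    fix w assume "\<forall>x\<in>?I. \<forall>z\<in>?J. y * (x * z) \<in> A" "w \<in> ideal_mult ?I ?J"
    then show "y * w \<in> A"
      unfolding ideal_mult_def by (auto simp only: sum_distrib_left mem_Collect_eq intro!: A.sum_mem)
  qed
  moreover have "(\<forall>x\<in>?I. \<forall>z\<in>?J. y * (x * z) \<in> A) \<longleftrightarrow> y \<in> (*) (1 / (b * c)) ` D (\<lambda>i. - (n i + m i))" for y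
  proof -
    have "(\<forall>x\<in>?I. \<forall>z\<in>?J. y * (x * z) \<in> A) \<longleftrightarrow> (\<forall>x\<in>D n. \<forall>z\<in>D m. (y * b * c * x) * z \<in> A)"
      by (simp add: mult_ac)
    also have "\<dots> \<longleftrightarrow> (\<forall>x\<in>D n. (y * b * c) * x \<in> D (\<lambda>i. 0 - m i))"
      by (subst D_transporter) simp
    also have "\<dots> \<longleftrightarrow> y * b * c \<in> D (\<lambda>i. 0 - m i - n i)"
      by (rule D_transporter)
    also have "(\<lambda>i. 0 - m i - n i) = (\<lambda>i. - (n i + m i))"
      by auto
    finally show ?thesis
      using assms by (subst scaled_D_iff) (simp_all add: mult.assoc)
  qed
  ultimately show ?thesis
    by (auto simp: colon_def frac_field_A)
qed

lemma divisorial_scaled_D: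
  assumes "b \<noteq> 0"
  shows "divisorial_ideal A ((*) b ` D n)"
proof -
  let ?I = "(*) b ` D n"
  have closed: "a * x \<in> D n" if "a \<in> A" "x \<in> D n" for a x
    using D_transporter[of n a n] that by simp
  have add: "x + y \<in> D n" if "x \<in> D n" "y \<in> D n" for x y
    using that unfolding D_def by (rule span_add)
  \<comment> \<open>Source of the common denominator: the numerator \<open>a\<close> of a nonzero
    element of the colon carries the whole ideal into \<open>A\<close>.\<close>
  obtain y where y: "y \<in> D (\<lambda>i. - n i)" "y \<noteq> 0"
    using D_nontrivial by blast
  then have yc: "y / b \<in> colon A ?I"
    unfolding transporter_scaled[OF assms] using assms by (subst scaled_D_iff) simp_all
  have "y / b \<in> frac_field A"
    by (simp add: frac_field_A)
  then obtain a c where ac: "a \<in> A" "c \<in> A" "c \<noteq> 0" "y / b = a / c"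
    unfolding frac_field_def by auto
  have "a * x \<in> A" if "x \<in> ?I" for x
  proof -
    have "y / b * x \<in> A"
      using yc that unfolding colon_def by blast
    with ac(2) have "c * (y / b * x) \<in> A"
      by (rule A.mult_mem)
    also have "c * (y / b * x) = a * x"
      unfolding ac(4) using ac(3) by simp
    finally show ?thesis .
  qed
  moreover have "a \<noteq> 0"
    using ac y(2) assms by auto
  ultimately have d: "\<exists>d\<in>A. d \<noteq> 0 \<and> (\<forall>x\<in>?I. d * x \<in> A)"
    using ac(1) by blast
  have "\<exists>x\<in>?I. x \<noteq> 0"
    using D_nontrivial[of n] assms by auto
  then have "?I \<noteq> {0}"
    by blast
  moreover have "0 \<in> ?I"
    using D_zero assms by (simp add: scaled_D_iff)
  moreover have "x + y \<in> ?I" if "x \<in> ?I" "y \<in> ?I" for x y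
    using that assms by (simp add: scaled_D_iff add_divide_distrib add)
  moreover have "c * x \<in> ?I" if "c \<in> A" "x \<in> ?I" for c x
    using closed[of c "x / b"] that assms by (simp add: scaled_D_iff)
  ultimately have "fractional_ideal A ?I" "?I \<noteq> {0}"
    unfolding fractional_ideal_def frac_field_A using d by blast+
  moreover have "colon A (colon A ?I) = ?I"
    using assms transporter_scaled[OF assms, of n] transporter_scaled[of "1 / b" "\<lambda>i. - n i"] by simp
  ultimately show ?thesis
    by (simp add: divisorial_ideal_def)
qed

text \<open>
  Since the Laurent polynomial ring has greatest common divisors, a divisorial ideal can be scaled
  so that it and its inverse generate the unit ideal there; then only the orders along the facets
  are left to describe it.
\<close>

lemma divisorial_imp_scaled_D:
  assumes "divisorial_ideal A I"
  shows "\<exists>b n. b \<noteq> 0 \<and> I = (*) b ` D n"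
proof -
  let ?B = "monomial_span UNIV"
  interpret B: complete_gcd_ring ?B
    by (rule gcd_laurent)
  define J where "J = colon A I"
  have I: "fractional_ideal A I" "I \<noteq> {0}" "\<And>y. y \<in> I \<longleftrightarrow> (\<forall>x\<in>J. y * x \<in> A)"
    using assms by (auto simp: divisorial_ideal_def J_def colon_def frac_field_A)
  obtain e where e: "e \<in> I" "e \<noteq> 0"
    using I(1,2) unfolding fractional_ideal_def by blast
  obtain d where d: "d \<in> J" "d \<noteq> 0"
    using I(1) unfolding fractional_ideal_def J_def colon_def frac_field_A by blast
  \<comment> \<open>Multiplying by \<open>e\<close> makes the inverse ideal \<open>J\<close>
    integral, so that it has a gcd \<open>g\<close> in the Laurent ring.\<close>
  let ?S = "(*) e ` J"
  have "?S \<subseteq> ?B"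
    using I(3) e(1) D_UNIV by blast
  moreover have "\<not> ?S \<subseteq> {0}"
    using d e by auto
  ultimately obtain g where g: "g \<noteq> 0" "\<And>y. (\<forall>s\<in>?S. y * s \<in> ?B) \<longleftrightarrow> y * g \<in> ?B"
    using B.ex_gcd by blast
  \<comment> \<open>After division by the gcd, only elements of the Laurent ring itself multiply
    \<open>K\<close> into that ring.\<close>
  define K where "K = (\<lambda>x. e * x / g) ` J"
  have K: "(\<forall>j\<in>K. y * j \<in> ?B) \<longleftrightarrow> y \<in> ?B" for y
    using g(2)[of "y / g"] g(1) by (simp add: K_def)
  have KB: "K \<subseteq> ?B"
    using K[of 1] B.one_mem by (simp add: subset_iff)
  have KI: "y \<in> I \<longleftrightarrow> (\<forall>j\<in>K. (y / (e / g)) * j \<in> A)" for y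
    using I(3)[of y] e(2) g(1) by (simp add: K_def)
  \<comment> \<open>\<open>Sup (N i)\<close> is the bound that \<open>K\<close> imposes along facet
    \<open>i\<close>. The supremum is finite because \<open>g\<close> carries \<open>K\<close> into
    \<open>A\<close>, so that the order of \<open>g\<close> bounds \<open>N i\<close>.\<close>
  define N where "N i = (\<lambda>j. - order_of (\<sigma> i) j) ` (K - {0})" for i
  have Kne: "e * d / g \<in> K - {0}"
    using d e g(1) by (auto simp: K_def)
  have gA: "\<forall>j\<in>K. g * j \<in> A"
    using KI[of e] e g(1) by simp
  then have gB: "g \<in> ?B"
    using iffD1[OF K[of g]] D_UNIV by blast
  have bdd: "bdd_above (N i)" if "i \<in> \<Phi>" for i
  proof (rule bdd_aboveI)
    fix x assume "x \<in> N i"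
    then obtain j where j: "j \<in> K" "j \<noteq> 0" "x = - order_of (\<sigma> i) j"
      by (auto simp: N_def)
    have "0 \<le> order_of (\<sigma> i) (g * j)"
      using gA j(1,2) g(1) that D_iff[of "g * j" "\<lambda>_. 0"] by simp
    also have "\<dots> = order_of (\<sigma> i) g + order_of (\<sigma> i) j"
      using gB g(1) KB j by (intro order_of_mult \<sigma>_add) auto
    finally show "x \<le> order_of (\<sigma> i) g"
      using j(3) by simp
  qed
  have "(\<forall>j\<in>K. w * j \<in> A) \<longleftrightarrow> w \<in> D (\<lambda>i. Sup (N i))" for w
  proof (cases "w = 0")
    case False
    have "(\<forall>j\<in>K. w * j \<in> A) \<longleftrightarrow> w \<in> ?B \<and> (\<forall>j\<in>K - {0}. \<forall>i\<in>\<Phi>. 0 \<le> order_of (\<sigma> i) (w * j))"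
      (is "?L \<longleftrightarrow> ?R")
    proof
      assume L: ?L
      then have "\<forall>j\<in>K. w * j \<in> ?B"
        by (intro ballI D_UNIV) (rule bspec)
      then have "w \<in> ?B"
        by (rule iffD1[OF K[of w]])
      moreover have "0 \<le> order_of (\<sigma> i) (w * j)" if "j \<in> K - {0}" "i \<in> \<Phi>" for i j
        using L False D_iff[of "w * j" "\<lambda>_. 0"] that by simp
      ultimately show ?R
        by simp
    next
      assume R: ?R
      show ?L
      proof
        fix j assume j: "j \<in> K"
        show "w * j \<in> A"
        proof (cases "j = 0")
          case False
          have "w * j \<in> ?B"
            using R j KB by (intro B.mult_mem) auto
          then show ?thesis
            using R j False \<open>w \<noteq> 0\<close> D_iff[of "w * j" "\<lambda>_. 0"] by simp
        qed (simp add: D_zero)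
      qed
    qed
    also have "\<dots> \<longleftrightarrow> w \<in> ?B \<and> (\<forall>i\<in>\<Phi>. \<forall>j\<in>K - {0}. - order_of (\<sigma> i) j \<le> order_of (\<sigma> i) w)"
    proof (rule conj_cong[OF refl])
      assume w: "w \<in> ?B"
      have "0 \<le> order_of (\<sigma> i) (w * j) \<longleftrightarrow> - order_of (\<sigma> i) j \<le> order_of (\<sigma> i) w"
        if "j \<in> K - {0}" for i j
      proof -
        have "order_of (\<sigma> i) (w * j) = order_of (\<sigma> i) w + order_of (\<sigma> i) j"
          using w that KB False by (intro order_of_mult \<sigma>_add) auto
        then show ?thesis by linarith
      qed
      then show "(\<forall>j\<in>K - {0}. \<forall>i\<in>\<Phi>. 0 \<le> order_of (\<sigma> i) (w * j)) \<longleftrightarrow>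
          (\<forall>i\<in>\<Phi>. \<forall>j\<in>K - {0}. - order_of (\<sigma> i) j \<le> order_of (\<sigma> i) w)"
        by blast
    qed
    also have "\<dots> \<longleftrightarrow> w \<in> ?B \<and> (\<forall>i\<in>\<Phi>. Sup (N i) \<le> order_of (\<sigma> i) w)"
    proof -
      have "N i \<noteq> {}" for i
        using Kne by (auto simp: N_def)
      then have "(\<forall>j\<in>K - {0}. - order_of (\<sigma> i) j \<le> order_of (\<sigma> i) w) \<longleftrightarrow> Sup (N i) \<le> order_of (\<sigma> i) w"
        if "i \<in> \<Phi>" for i
        using bdd[OF that] by (subst cSup_le_iff) (auto simp: N_def)
      then show ?thesis by blast
    qed
    also have "\<dots> \<longleftrightarrow> w \<in> D (\<lambda>i. Sup (N i))"
      using False by (simp add: D_iff)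
    finally show ?thesis .
  qed (simp add: D_zero)
  moreover have eg: "e / g \<noteq> 0"
    using e(2) g(1) by simp
  ultimately have "y \<in> I \<longleftrightarrow> y \<in> (*) (e / g) ` D (\<lambda>i. Sup (N i))" for y
    by (simp only: KI scaled_D_iff[OF eg])
  then have "I = (*) (e / g) ` D (\<lambda>i. Sup (N i))"
    by blast
  with eg show ?thesis
    by blast
qed

section \<open>Units of the Laurent ring and equality of scaled monomial ideals\<close>

lemma supp_one: "supp 1 = {0}"
  using supp_mon[of 1 0] by (simp add: emb_one mon_zero)

text \<open>Lowest and highest \<open>\<sigma> i\<close>-degree are both additive, the latter as the
  order along the negated form. Each sums to zero over \<open>a\<close> and \<open>b\<close>, so
  every \<open>\<sigma> i\<close> is constant on the support of \<open>a\<close>, and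
  \<open>separating\<close> leaves a single exponent.\<close>

lemma unit_imp_monomial:
  assumes a: "a \<in> monomial_span UNIV" and b: "b \<in> monomial_span UNIV" and ab: "a * b = 1"
  shows "\<exists>u. supp a = {u}"
proof -
  have nz: "a \<noteq> 0" "b \<noteq> 0"
    using ab by auto
  obtain v where v: "v \<in> supp b"
    using supp_nonempty[OF b nz(2)] by blast
  have const: "\<sigma> i u = - \<sigma> i v" if u: "u \<in> supp a" for i u
  proof -
    have "order_of (\<sigma> i) a + order_of (\<sigma> i) b = 0"
      using order_of_mult[of "\<sigma> i", OF \<sigma>_add a nz(1) b nz(2)] by (simp add: ab order_of_def supp_one \<sigma>_zero)
    moreover have "order_of (\<lambda>u. - \<sigma> i u) a + order_of (\<lambda>u. - \<sigma> i u) b = 0"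
      using order_of_mult[of "\<lambda>u. - \<sigma> i u", OF _ a nz(1) b nz(2)] by (simp add: ab order_of_def supp_one \<sigma>_zero \<sigma>_add)
    ultimately show ?thesis
      using order_of_le[OF u, of "\<sigma> i"] order_of_le[OF v, of "\<sigma> i"]
        order_of_le[OF u, of "\<lambda>u. - \<sigma> i u"] order_of_le[OF v, of "\<lambda>u. - \<sigma> i u"] by linarith
  qed
  have "u = - v" if "u \<in> supp a" for u
    using separating[of "u + v"] const[OF that] by (simp add: \<sigma>_add add_eq_0_iff2)
  then show ?thesis
    using supp_nonempty[OF a nz(1)] by blast
qed

text \<open>\<open>b\<close> and \<open>1 / b\<close> both lie in the Laurent ring, so
  \<open>b\<close> has a single exponent \<open>u\<close>. The inequalities for \<open>b\<close> and
  for \<open>1 / b\<close> together are equalities at \<open>u\<close>.\<close>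

lemma scaled_D_eq_D_imp:
  assumes b: "b \<noteq> 0" and eq: "(*) b ` D n = D m"
  shows "\<exists>u. \<forall>i\<in>\<Phi>. m i = n i + \<sigma> i u"
proof -
  have "\<forall>x\<in>D n. b * x \<in> D m"
    using eq by blast
  then have bD: "b \<in> D (\<lambda>i. m i - n i)"
    by (simp add: D_transporter)
  have "\<forall>x\<in>D m. 1 / b * x \<in> D n"
    using b by (auto simp: scaled_D_iff simp flip: eq)
  then have bD': "1 / b \<in> D (\<lambda>i. n i - m i)"
    by (rule iffD1[OF D_transporter])
  obtain u where u: "supp b = {u}"
    using unit_imp_monomial[OF D_UNIV[OF bD] D_UNIV[OF bD']] b by auto
  have ord: "order_of (\<sigma> i) b + order_of (\<sigma> i) (1 / b) = 0" for i
    using order_of_mult[of "\<sigma> i", OF \<sigma>_add D_UNIV[OF bD] b D_UNIV[OF bD']] b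
    by (simp add: order_of_def supp_one \<sigma>_zero)
  have "m i = n i + \<sigma> i u" if "i \<in> \<Phi>" for i
    using that ord[of i] b bD bD' u by (force simp: D_iff order_of_def)
  then show ?thesis by blast
qed

lemma mon_scaled_D: "(*) (mon u) ` D n = D (\<lambda>i. n i + \<sigma> i u)"
proof -
  have "y \<in> (*) (mon u) ` D n \<longleftrightarrow> mon (- u) * y \<in> D n" for y
    unfolding scaled_D_iff[OF mon_nonzero] by (simp add: mon_minus divide_inverse mult.commute[of y])
  also have "\<dots> y \<longleftrightarrow> y \<in> D (\<lambda>i. n i + \<sigma> i u)" for y
    unfolding D_def span_shift by (intro arg_cong2[of _ _ _ _ "(\<in>)"] arg_cong[of _ _ monomial_span])
      (auto simp: \<sigma>_diff algebra_simps)
  finally show ?thesis by blast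
qed

section \<open>The divisor group and its classes\<close>

abbreviation G where "G \<equiv> divisor_group A"
abbreviation P where "P \<equiv> principal_divisors A"

lemma carrier_G: "carrier G = {(*) b ` D n | b n. b \<noteq> 0}"
proof -
  have "divisorial_ideal A I \<longleftrightarrow> (\<exists>b n. I = (*) b ` D n \<and> b \<noteq> 0)" for I
    using divisorial_scaled_D divisorial_imp_scaled_D[of I] by blast
  then show ?thesis
    by (simp add: divisor_group_def)
qed

lemma scaled_D_in_G: "b \<noteq> 0 \<Longrightarrow> (*) b ` D n \<in> carrier G"
  by (auto simp: carrier_G)

lemma D_in_G: "D n \<in> carrier G"
  using scaled_D_in_G[of 1 n] by simp

lemma mult_G:
  assumes "b \<noteq> 0" "c \<noteq> 0"
  shows "((*) b ` D n) \<otimes>\<^bsub>G\<^esub> ((*) c ` D m) = (*) (b * c) ` D (\<lambda>i. n i + m i)"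
  using assms colon_mult[OF assms, of n m] transporter_scaled[of "1 / (b * c)" "\<lambda>i. - (n i + m i)"]
  by (simp add: divisor_group_def add.commute)

lemma one_G: "\<one>\<^bsub>G\<^esub> = A"
  by (simp add: divisor_group_def)

lemma comm_group_G: "comm_group G"
proof (rule comm_groupI)
  fix I J assume "I \<in> carrier G" "J \<in> carrier G"
  then obtain b n c m where *: "b \<noteq> 0" "c \<noteq> 0" "I = (*) b ` D n" "J = (*) c ` D m"
    by (auto simp: carrier_G)
  show "I \<otimes>\<^bsub>G\<^esub> J \<in> carrier G"
    using * by (simp add: mult_G scaled_D_in_G)
  show "I \<otimes>\<^bsub>G\<^esub> J = J \<otimes>\<^bsub>G\<^esub> I"
    unfolding *(3,4) mult_G[OF *(1,2)] mult_G[OF *(2,1)]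
    by (simp only: mult.commute[of b c] add.commute)
  fix K assume "K \<in> carrier G"
  then obtain d k where "d \<noteq> 0" "K = (*) d ` D k"
    by (auto simp: carrier_G)
  with * show "I \<otimes>\<^bsub>G\<^esub> J \<otimes>\<^bsub>G\<^esub> K = I \<otimes>\<^bsub>G\<^esub> (J \<otimes>\<^bsub>G\<^esub> K)"
    by (simp add: mult_G) (simp only: mult.assoc add.assoc)
next
  show "\<one>\<^bsub>G\<^esub> \<in> carrier G"
    by (simp add: one_G D_in_G)
next
  fix I assume "I \<in> carrier G"
  then obtain b n where *: "b \<noteq> 0" "I = (*) b ` D n"
    by (auto simp: carrier_G)
  show "\<one>\<^bsub>G\<^esub> \<otimes>\<^bsub>G\<^esub> I = I"
    using mult_G[of 1 b "\<lambda>_. 0" n] * by (simp add: one_G)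
  show "\<exists>J\<in>carrier G. J \<otimes>\<^bsub>G\<^esub> I = \<one>\<^bsub>G\<^esub>"
    using * by (intro bexI[of _ "(*) (inverse b) ` D (\<lambda>i. - n i)"]) (simp_all add: mult_G one_G scaled_D_in_G)
qed

lemma principal_divisors_A: "P = {(*) b ` A | b. b \<noteq> 0}"
  by (simp add: principal_divisors_def frac_field_A)

lemma subgroup_P: "subgroup P G"
proof -
  interpret G: comm_group G by (rule comm_group_G)
  have mult: "((*) b ` A) \<otimes>\<^bsub>G\<^esub> ((*) c ` A) = (*) (b * c) ` A" if "b \<noteq> 0" "c \<noteq> 0" for b c
    using mult_G[OF that, of "\<lambda>_. 0" "\<lambda>_. 0"] by simp
  show ?thesis
  proof (rule G.subgroupI)
    show "P \<subseteq> carrier G"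
      by (auto simp: principal_divisors_A scaled_D_in_G)
    show "P \<noteq> {}"
      by (auto simp: principal_divisors_A intro: exI[of _ 1])
  next
    fix I assume "I \<in> P"
    then obtain b where b: "b \<noteq> 0" "I = (*) b ` A"
      by (auto simp: principal_divisors_A)
    have "inv\<^bsub>G\<^esub> I = (*) (inverse b) ` A"
      using b by (intro G.inv_equality) (simp_all add: mult one_G scaled_D_in_G)
    moreover have "inverse b \<noteq> 0"
      using b by simp
    ultimately show "inv\<^bsub>G\<^esub> I \<in> P"
      unfolding principal_divisors_A by blast
  next
    fix I J assume "I \<in> P" "J \<in> P"
    then obtain b c where bc: "b \<noteq> 0" "c \<noteq> 0" "I = (*) b ` A" "J = (*) c ` A"
      by (auto simp: principal_divisors_A)
    then have "I \<otimes>\<^bsub>G\<^esub> J = (*) (b * c) ` A" "b * c \<noteq> 0"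
      by (simp_all add: mult)
    then show "I \<otimes>\<^bsub>G\<^esub> J \<in> P"
      unfolding principal_divisors_A by blast
  qed
qed

lemma comm_group_class_group: "comm_group (class_group A)"
  unfolding class_group_def using comm_group.abelian_FactGroup[OF comm_group_G subgroup_P] .

definition cls :: "('i \<Rightarrow> int) \<Rightarrow> 'f set set" where
  "cls n = P #>\<^bsub>G\<^esub> D n"

text \<open>A scaled ideal is a principal ideal times some \<open>D n\<close>, so every class has a
  monomial representative.\<close>

lemma carrier_class_group: "carrier (class_group A) = range cls"
proof -
  interpret G: comm_group G by (rule comm_group_G)
  have "P #>\<^bsub>G\<^esub> ((*) b ` D n) = cls n" if "b \<noteq> 0" for b n
  proof -
    have "(*) b ` D n = ((*) b ` A) \<otimes>\<^bsub>G\<^esub> D n"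
      using mult_G[OF that, of 1 "\<lambda>_. 0" n] by simp
    then have "(*) b ` D n \<in> cls n"
      using that unfolding cls_def r_coset_def principal_divisors_A by blast
    then show ?thesis
      unfolding cls_def using G.repr_independence[OF _ D_in_G subgroup_P] by simp
  qed
  moreover have "cls n = P #>\<^bsub>G\<^esub> ((*) 1 ` D n)" for n
    by (simp add: cls_def)
  ultimately show ?thesis
    unfolding class_group_def FactGroup_def RCOSETS_def
    by (auto simp: carrier_G) (metis one_neq_zero)
qed

lemma mult_cls: "cls n \<otimes>\<^bsub>class_group A\<^esub> cls m = cls (\<lambda>i. n i + m i)"
proof -
  interpret G: comm_group G by (rule comm_group_G)
  interpret normal P G
    using subgroup_P by (rule G.subgroup_imp_normal)
  show ?thesis
    using mult_G[of 1 1 n m] rcos_sum[OF D_in_G D_in_G, of n m]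
    by (simp add: class_group_def FactGroup_def cls_def)
qed

text \<open>Equality of classes yields some \<open>b\<close> scaling \<open>D n\<close> to
  \<open>D m\<close>; such a \<open>b\<close> is a unit of the Laurent ring, hence a monomial up to
  a scalar.\<close>

lemma cls_eq_iff: "cls n = cls m \<longleftrightarrow> (\<exists>u. \<forall>i\<in>\<Phi>. m i = n i + \<sigma> i u)"
proof -
  interpret G: comm_group G by (rule comm_group_G)
  have "cls n = cls m \<longleftrightarrow> D m \<in> cls n"
    using G.repr_independence[OF _ D_in_G subgroup_P] G.rcos_self[OF D_in_G subgroup_P]
    by (auto simp: cls_def)
  also have "\<dots> \<longleftrightarrow> (\<exists>b. b \<noteq> 0 \<and> (*) b ` D n = D m)"
    using mult_G[of _ 1 "\<lambda>_. 0" n] by (auto simp: cls_def r_coset_def principal_divisors_A)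
  also have "\<dots> \<longleftrightarrow> (\<exists>u. \<forall>i\<in>\<Phi>. m i = n i + \<sigma> i u)"
  proof (intro iffI; elim exE conjE)
    fix u assume "\<forall>i\<in>\<Phi>. m i = n i + \<sigma> i u"
    then have "D (\<lambda>i. n i + \<sigma> i u) = D m"
      by (intro D_cong) simp
    then show "\<exists>b. b \<noteq> 0 \<and> (*) b ` D n = D m"
      using mon_scaled_D mon_nonzero by metis
  qed (rule scaled_D_eq_D_imp)
  finally show ?thesis .
qed

text \<open>
  The class group is the cokernel of \<open>u \<mapsto> (\<sigma> i u)\<^sub>i\<close>. If the facets in \<open>\<Phi>0\<close> form coordinates
  of the lattice, then they can be used to eliminate all other relations.
\<close>

lemma class_group_iso:
  fixes \<iota> :: "'j \<Rightarrow> 'i"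
  assumes "\<Phi>0 \<subseteq> \<Phi>" and coords: "\<And>n. \<exists>u. \<forall>i\<in>\<Phi>0. \<sigma> i u = n i"
    and coords_inj: "\<And>u. (\<And>i. i \<in> \<Phi>0 \<Longrightarrow> \<sigma> i u = 0) \<Longrightarrow> u = 0"
    and \<iota>: "bij_betw \<iota> J (\<Phi> - \<Phi>0)"
  shows "class_group A \<cong> product_group J (\<lambda>_. integer_group)"
proof -
  interpret C: comm_group "class_group A" by (rule comm_group_class_group)
  let ?Z = "product_group J (\<lambda>_. integer_group)"
  \<comment> \<open>Representatives that vanish on \<open>\<Phi>0\<close>, the normal form to which
    lattice translations bring each class.\<close>
  define ext where "ext c i = (if i \<in> \<Phi>0 then 0 else c (inv_into J \<iota> i))" for c :: "'j \<Rightarrow> int" and i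
  have ext_\<iota>: "ext c (\<iota> j) = c j" if "j \<in> J" for c j
    using that \<iota> by (auto simp: ext_def bij_betw_def)
  have ext_0: "ext c i = 0" if "i \<in> \<Phi>0" for c i
    using that by (simp add: ext_def)
  have cls_eqI: "cls n = cls m"
    if "\<And>i. i \<in> \<Phi>0 \<Longrightarrow> n i = m i" "\<And>j. j \<in> J \<Longrightarrow> n (\<iota> j) = m (\<iota> j)" for n m
  proof -
    have "n i = m i" if "i \<in> \<Phi>" for i
    proof (cases "i \<in> \<Phi>0")
      case False
      then have "i \<in> \<iota> ` J"
        using \<open>i \<in> \<Phi>\<close> \<iota> by (simp add: bij_betw_def)
      then show ?thesis
        using \<open>\<And>j. j \<in> J \<Longrightarrow> n (\<iota> j) = m (\<iota> j)\<close> by blast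
    qed (rule \<open>\<And>i. i \<in> \<Phi>0 \<Longrightarrow> n i = m i\<close>)
    then show ?thesis
      using D_cong[of n m] by (simp add: cls_def)
  qed
  have "(\<lambda>c. cls (ext c)) \<in> iso ?Z (class_group A)"
  proof (rule isoI)
    show "(\<lambda>c. cls (ext c)) \<in> hom ?Z (class_group A)"
    proof (rule homI)
      fix c d
      have "cls (ext (c \<otimes>\<^bsub>?Z\<^esub> d)) = cls (\<lambda>i. ext c i + ext d i)"
        by (rule cls_eqI) (simp_all add: ext_0 ext_\<iota>)
      then show "cls (ext (c \<otimes>\<^bsub>?Z\<^esub> d)) = cls (ext c) \<otimes>\<^bsub>class_group A\<^esub> cls (ext d)"
        by (simp add: mult_cls)
    qed (simp add: carrier_class_group)
    show "bij_betw (\<lambda>c. cls (ext c)) (carrier ?Z) (carrier (class_group A))"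
    proof (rule bij_betw_imageI)
      show "inj_on (\<lambda>c. cls (ext c)) (carrier ?Z)"
      proof (rule inj_onI)
        fix c d assume c: "c \<in> carrier ?Z" "d \<in> carrier ?Z" and "cls (ext c) = cls (ext d)"
        then obtain u where u: "\<forall>i\<in>\<Phi>. ext d i = ext c i + \<sigma> i u"
          by (auto simp: cls_eq_iff)
        have "u = 0"
        proof (rule coords_inj)
          fix i assume i: "i \<in> \<Phi>0"
          then have "ext d i = ext c i + \<sigma> i u"
            using u assms(1) by blast
          then show "\<sigma> i u = 0"
            by (simp add: ext_0[OF i])
        qed
        have "c j = d j" if "j \<in> J" for j
        proof -
          have "\<iota> j \<in> \<Phi>"
            using that \<iota> by (auto simp: bij_betw_def)
          then have "ext d (\<iota> j) = ext c (\<iota> j) + \<sigma> (\<iota> j) u"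
            using u by blast
          then show ?thesis
            by (simp add: ext_\<iota>[OF that] \<open>u = 0\<close> \<sigma>_zero)
        qed
        then show "c = d"
          using c by (intro PiE_ext[of c J _ d]) auto
      qed
      show "(\<lambda>c. cls (ext c)) ` carrier ?Z = carrier (class_group A)"
      proof (intro equalityI subsetI)
        fix x assume "x \<in> carrier (class_group A)"
        then obtain n where n: "x = cls n"
          by (auto simp: carrier_class_group)
        \<comment> \<open>The translation that clears the \<open>\<Phi>0\<close> coordinates of
          \<open>n\<close>.\<close>
        obtain u where u: "\<forall>i\<in>\<Phi>0. \<sigma> i u = - n i"
          using coords[of "\<lambda>i. - n i"] by blast
        define c where "c = (\<lambda>j\<in>J. n (\<iota> j) + \<sigma> (\<iota> j) u)"
        have "cls n = cls (\<lambda>i. n i + \<sigma> i u)"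
          by (auto simp: cls_eq_iff)
        also have "\<dots> = cls (ext c)"
          by (rule cls_eqI) (simp_all add: u ext_0 ext_\<iota> c_def)
        finally show "x \<in> (\<lambda>c. cls (ext c)) ` carrier ?Z"
          using n by (auto intro!: image_eqI[of _ _ c] simp: c_def)
      qed (auto simp: carrier_class_group)
    qed
  qed
  then have "?Z \<cong> class_group A"
    by (auto simp: is_iso_def)
  then show ?thesis
    by (rule group.iso_sym[rotated]) simp
qed

end

section \<open>Perfect graphs\<close>

lemma ex_maximal_clique:
  fixes E :: "'v::finite \<Rightarrow> 'v \<Rightarrow> bool"
  assumes "clique E C"
  shows "\<exists>D. maximal_clique E D \<and> C \<subseteq> D"
proof -
  have "finite {D. clique E D \<and> C \<subseteq> D}"
    by simp
  moreover have "C \<in> {D. clique E D \<and> C \<subseteq> D}"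
    using assms by simp
  ultimately obtain D where "D \<in> {D. clique E D \<and> C \<subseteq> D}"
    "\<forall>D'\<in>{D. clique E D \<and> C \<subseteq> D}. D \<subseteq> D' \<longrightarrow> D = D'"
    by (meson finite_has_maximal2)
  then show ?thesis
    unfolding maximal_clique_def by (intro exI[of _ D]) auto
qed

lemma card_clique_Int_stable_set:
  fixes C W :: "'v::finite set"
  assumes "clique E C" "stable_set E W"
  shows "card (C \<inter> W) \<le> 1"
proof -
  have "x = y" if "x \<in> C \<inter> W" "y \<in> C \<inter> W" for x y
    using that assms unfolding clique_def stable_set_def pairwise_def by blast
  then show ?thesis
    by (simp add: card_le_Suc0_iff_eq)
qed

text \<open>\<open>LEAST\<close> has a witness: giving all vertices different colours is proper, as
  no vertex is its own neighbour.\<close>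

lemma ex_proper_colouring:
  fixes E :: "'v::finite \<Rightarrow> 'v \<Rightarrow> bool"
  assumes "irreflp E"
  shows "\<exists>c. proper_colouring E W (chromatic_number E W) c"
  unfolding chromatic_number_def
proof (rule LeastI_ex)
  obtain c :: "'v \<Rightarrow> nat" where "bij_betw c UNIV {0..<CARD('v)}"
    using ex_bij_betw_finite_nat[of "UNIV :: 'v set"] by auto
  then have "proper_colouring E W CARD('v) c"
    using assms unfolding proper_colouring_def bij_betw_def irreflp_def by (auto simp: inj_eq)
  then show "\<exists>k c. proper_colouring E W k c"
    by blast
qed

text \<open>
  Lovasz's replication lemma in weighted form. If \<open>a v \<ge> 2\<close>, a cover of \<open>a - e\<^sub>v\<close> contains a stable
  set \<open>S\<close> through \<open>v\<close>, and \<open>a - \<rho>(S)\<close> satisfies the hypothesis with \<open>m - 1\<close>.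
\<close>

lemma perfect_graph_stable_cover:
  fixes E :: "'v::finite \<Rightarrow> 'v \<Rightarrow> bool" and a :: "'v \<Rightarrow> nat"
  assumes G: "irreflp E" "perfect_graph E" and "\<And>C. clique E C \<Longrightarrow> sum a C \<le> m"
  shows "\<exists>W. (\<forall>j<m. stable_set E (W j)) \<and> (\<forall>v. (\<Sum>j<m. of_bool (v \<in> W j)) = a v)"
  using assms(3)
proof (induction "sum a UNIV" arbitrary: a m rule: less_induct)
  case less
  note a = less.prems
  show ?case
  proof (cases "\<forall>v. a v \<le> 1")
    case True
    \<comment> \<open>Here \<open>a\<close> is the indicator of \<open>U\<close>, so the hypothesis
      bounds the clique number of \<open>U\<close>, and perfection turns this into a bound on
      colours. Colours that do not occur give empty stable sets.\<close>
    define U where "U = {v. a v = 1}"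
    have aU: "a v = of_bool (v \<in> U)" for v
      using True[rule_format, of v] by (auto simp: U_def)
    have "card C \<le> m" if "C \<subseteq> U" "clique E C" for C
    proof -
      have "sum a C = card C"
        using that(1) by (simp add: U_def subset_iff)
      then show ?thesis using a[OF that(2)] by simp
    qed
    then have "clique_number E U \<le> m"
      unfolding clique_number_def by (subst Max_le_iff) (auto simp: clique_def intro: exI[of _ "{}"])
    then have "chromatic_number E U \<le> m"
      using G(2) by (simp add: perfect_graph_def)
    moreover obtain c where c: "proper_colouring E U (chromatic_number E U) c"
      using ex_proper_colouring[OF G(1)] by blast
    ultimately have cm: "c v < m" if "v \<in> U" for v
      using that by (force simp: proper_colouring_def)
    let ?W = "\<lambda>j. {v\<in>U. c v = j}"
    have "stable_set E (?W j)" for j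
      using c unfolding stable_set_def pairwise_def proper_colouring_def
      by (metis (mono_tags, lifting) mem_Collect_eq)
    moreover have "(\<Sum>j<m. of_bool (v \<in> ?W j)) = a v" for v
      using cm[of v] by (cases "v \<in> U") (simp_all add: aU of_bool_def sum.delta)
    ultimately show ?thesis
      by (intro exI[of _ ?W]) blast
  next
    case False
    then obtain v where v: "2 \<le> a v"
      by (auto simp: not_le Suc_le_eq numeral_2_eq_2)
    define a' where "a' = a(v := a v - 1)"
    have a'_le: "a' u \<le> a u" for u
      by (simp add: a'_def)
    have "sum a' UNIV < sum a UNIV"
      using a'_le v by (intro sum_strict_mono_ex1) (auto simp: a'_def intro: bexI[of _ v])
    moreover have "sum a' C \<le> m" if "clique E C" for C
      using a[OF that] sum_mono[of C a' a, OF a'_le] by simp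
    ultimately obtain W where W: "\<forall>j<m. stable_set E (W j)" "\<And>u. (\<Sum>j<m. of_bool (u \<in> W j)) = a' u"
      using less.hyps[of a' m] by blast
    \<comment> \<open>The decremented weight of \<open>v\<close> is still at least one, so some set
      of the cover passes through \<open>v\<close>.\<close>
    have "(\<Sum>j<m. of_bool (v \<in> W j)) \<noteq> (0::nat)"
      using W(2)[of v] v by (simp add: a'_def)
    then obtain k where k: "k < m" "v \<in> W k"
      by (auto simp: of_bool_def split: if_splits)
    define b where "b u = a u - of_bool (u \<in> W k)" for u
    \<comment> \<open>\<open>W k\<close> belongs to a cover with weights \<open>a'\<close>, so the
      truncated subtraction in \<open>b\<close> loses nothing.\<close>
    have Wk: "of_bool (u \<in> W k) \<le> a' u" for u
      using member_le_sum[of k "{..<m}" "\<lambda>j. of_bool (u \<in> W j) :: nat"] W(2)[of u] k(1) by simp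
    have ab: "a u = b u + of_bool (u \<in> W k)" for u
      using Wk[of u] a'_le[of u] by (simp add: b_def)
    have "sum b UNIV < sum a UNIV"
      using k(2) v by (intro sum_strict_mono_ex1) (auto simp: b_def intro!: exI[of _ v])
    \<comment> \<open>A clique through \<open>v\<close> meets \<open>W k\<close> and loses weight. A
      clique avoiding \<open>v\<close> has equal weight under \<open>a\<close> and
      \<open>a'\<close>, and without \<open>W k\<close> only \<open>m - 1\<close> stable sets are
      left, each meeting it at most once.\<close>
    moreover have "sum b C \<le> m - 1" if C: "clique E C" for C
    proof (cases "v \<in> C")
      case True
      have "sum a C = sum b C + (\<Sum>u\<in>C. of_bool (u \<in> W k))"
        by (simp add: ab sum.distrib)
      moreover have "1 \<le> (\<Sum>u\<in>C. of_bool (u \<in> W k) :: nat)"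
        using member_le_sum[of v C "\<lambda>u. of_bool (u \<in> W k) :: nat"] True k(2) by simp
      ultimately show ?thesis
        using a[OF C] by simp
    next
      case False
      have one: "(\<Sum>u\<in>C. of_bool (u \<in> W j)) \<le> (1::nat)" if "j < m" for j
      proof -
        have "card (C \<inter> W j) \<le> 1"
          using C W(1) that by (intro card_clique_Int_stable_set) auto
        then show ?thesis
          by (simp add: sum_of_bool_eq)
      qed
      have "sum b C = (\<Sum>u\<in>C. \<Sum>j\<in>{..<m} - {k}. of_bool (u \<in> W j))"
      proof (rule sum.cong[OF refl])
        fix u assume "u \<in> C"
        then have "a u = a' u"
          using False by (auto simp: a'_def)
        also have "\<dots> = of_bool (u \<in> W k) + (\<Sum>j\<in>{..<m} - {k}. of_bool (u \<in> W j))"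
          unfolding W(2)[symmetric] using k(1) by (intro sum.remove) auto
        finally show "b u = (\<Sum>j\<in>{..<m} - {k}. of_bool (u \<in> W j))"
          using ab[of u] by simp
      qed
      also have "\<dots> = (\<Sum>j\<in>{..<m} - {k}. \<Sum>u\<in>C. of_bool (u \<in> W j))"
        by (rule sum.swap)
      also have "\<dots> \<le> (\<Sum>j\<in>{..<m} - {k}. 1)"
        using one by (intro sum_mono) auto
      also have "\<dots> = m - 1"
        using k(1) by simp
      finally show ?thesis .
    qed
    ultimately obtain W' where W': "\<forall>j<m - 1. stable_set E (W' j)"
      "\<And>u. (\<Sum>j<m - 1. of_bool (u \<in> W' j)) = b u"
      using less.hyps[of b "m - 1"] by blast
    define W'' where "W'' = W'(m - 1 := W k)"
    obtain l where l: "m = Suc l"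
      using k(1) by (cases m) auto
    have "\<forall>j<m. stable_set E (W'' j)"
      using W'(1) W(1) k(1) by (auto simp: W''_def l less_Suc_eq)
    moreover have "(\<Sum>j<m. of_bool (u \<in> W'' j)) = a u" for u
      using W'(2)[of u] by (simp add: ab W''_def l)
    ultimately show ?thesis
      by (intro exI[of _ W'']) blast
  qed
qed

text \<open>The inequalities cut out a convex set containing all incidence vectors. The converse is
  supplied on lattice points by \<open>perfect_graph_stable_cover\<close>.\<close>

lemma stable_set_polytope_inequalities:
  fixes E :: "'v::finite \<Rightarrow> 'v \<Rightarrow> bool"
  assumes "x \<in> stable_set_polytope E"
  shows "0 \<le> x $ v" and "clique E C \<Longrightarrow> (\<Sum>v\<in>C. x $ v) \<le> 1"
proof -
  let ?S = "{x :: real ^ 'v. (\<forall>v. 0 \<le> x $ v) \<and> (\<forall>C. clique E C \<longrightarrow> (\<Sum>v\<in>C. x $ v) \<le> 1)}"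
  have inc: "incidence_vector W $ v = of_bool (v \<in> W)" for W :: "'v set" and v
    by (simp add: incidence_vector_def sum_component axis_def of_bool_def sum.delta)
  have "incidence_vector ` {W. stable_set E W} \<subseteq> ?S"
  proof clarify
    fix W assume W: "stable_set E W"
    have "(\<Sum>v\<in>C. incidence_vector W $ v) \<le> 1" if C: "clique E C" for C
    proof -
      have "card (C \<inter> W) \<le> 1"
        using C W by (rule card_clique_Int_stable_set)
      then show ?thesis
        by (simp add: inc sum_of_bool_eq)
    qed
    then show "(\<forall>v. 0 \<le> incidence_vector W $ v) \<and> (\<forall>C. clique E C \<longrightarrow> (\<Sum>v\<in>C. incidence_vector W $ v) \<le> 1)"
      by (simp add: inc)
  qed
  moreover have "convex ?S"
  proof (rule convexI)
    fix x y :: "real ^ 'v" and s t :: real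
    assume xy: "x \<in> ?S" "y \<in> ?S" and st: "0 \<le> s" "0 \<le> t" "s + t = 1"
    have "(\<Sum>v\<in>C. s * x $ v + t * y $ v) \<le> 1" if C: "clique E C" for C
    proof -
      have "(\<Sum>v\<in>C. s * x $ v + t * y $ v) = s * (\<Sum>v\<in>C. x $ v) + t * (\<Sum>v\<in>C. y $ v)"
        by (simp add: sum.distrib sum_distrib_left)
      also have "\<dots> \<le> s * 1 + t * 1"
        using xy st C by (intro add_mono mult_left_mono) auto
      finally show ?thesis using st by simp
    qed
    then show "s *\<^sub>R x + t *\<^sub>R y \<in> ?S"
      using xy st by simp
  qed
  ultimately have "stable_set_polytope E \<subseteq> ?S"
    unfolding stable_set_polytope_def by (rule hull_minimal)
  then show "0 \<le> x $ v" and "clique E C \<Longrightarrow> (\<Sum>v\<in>C. x $ v) \<le> 1"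
    using assms by auto
qed

lemma incidence_vector_in_polytope: "stable_set E W \<Longrightarrow> incidence_vector W \<in> stable_set_polytope E"
  unfolding stable_set_polytope_def by (rule hull_inc) simp

section \<open>The Laurent polynomial ring\<close>

type_synonym 'v exponent = "('v \<Rightarrow>\<^sub>0 int) \<times> int"

definition fract_t :: "('v::{finite,linorder}, 'k::field) laurent_t fract" where
  "fract_t = Fract (Polynomial.monom 1 1) 1"

definition fract_emb :: "'k::field \<Rightarrow> ('v::{finite,linorder}, 'k) laurent_t fract" where
  "fract_emb c = Fract [:Poly_Mapping.single 0 c:] 1"

text \<open>The ambient ring is polynomial in \<open>t\<close>, so negative powers of
  \<open>t\<close> exist only in its fraction field; hence the integer power there.\<close>

definition fract_mon :: "'v::{finite,linorder} exponent \<Rightarrow> ('v, 'k::field) laurent_t fract" where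
  "fract_mon u = Fract [:Poly_Mapping.single (fst u) 1:] 1 * fract_t powi snd u"

lemma fract_t_nonzero: "fract_t \<noteq> 0"
  by (simp add: fract_t_def Zero_fract_def eq_fract)

lemma Fract_one_mult: "Fract (p * q) 1 = Fract p 1 * Fract q (1 :: 'a::idom)"
  by simp

lemma Fract_one_add: "Fract (p + q) 1 = Fract p 1 + Fract q (1 :: 'a::idom)"
  by simp

lemma Fract_one_sum: "Fract (sum f A) 1 = (\<Sum>i\<in>A. Fract (f i) (1 :: 'a::idom))"
  by (induction A rule: infinite_finite_induct) (simp_all add: Fract_one_add Zero_fract_def del: add_fract)

lemma Fract_one_eq_0_iff: "Fract p (1 :: 'a::idom) = 0 \<longleftrightarrow> p = 0"
  by (simp add: Zero_fract_def eq_fract)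

lemma fract_t_power: "fract_t ^ n = Fract (Polynomial.monom 1 n) 1"
  by (induction n) (simp_all add: fract_t_def One_fract_def Polynomial.mult_monom)

lemma fract_emb_mult_mon:
  assumes "0 \<le> snd u"
  shows "fract_emb c * fract_mon u = Fract (Polynomial.monom (Poly_Mapping.single (fst u) c) (nat (snd u))) 1"
  using assms
  by (simp add: fract_emb_def fract_mon_def power_int_def fract_t_power Polynomial.smult_monom
      Poly_Mapping.mult_single)

lemma fract_mon_add: "fract_mon (u + v) = fract_mon u * fract_mon v"
proof -
  have "Fract [:Poly_Mapping.single (fst u + fst v) 1:] 1 =
      Fract [:Poly_Mapping.single (fst u) 1:] 1 * Fract [:Poly_Mapping.single (fst v) (1::'b):] 1"
    by (simp add: Poly_Mapping.mult_single add.commute)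
  moreover have "fract_t powi (snd u + snd v) = fract_t powi snd u * (fract_t :: ('a, 'b) laurent_t fract) powi snd v"
    by (rule power_int_add) (simp add: fract_t_nonzero)
  ultimately show ?thesis
    by (simp only: fract_mon_def fst_add snd_add mult_ac)
qed

text \<open>For independence, a power of \<open>t\<close> clears the negative exponents; in the
  ambient ring distinct exponents then occupy distinct coefficients.\<close>

lemma laurent_monomials_fract:
  "laurent_monomials (fract_mon :: _ \<Rightarrow> ('v::{finite,linorder}, 'k::field) laurent_t fract) fract_emb"
proof
  show "fract_mon 0 = 1"
    by (simp add: fract_mon_def One_fract_def one_pCons)
  show "fract_mon (u + v) = fract_mon u * fract_mon v" for u v
    by (rule fract_mon_add)
  show "fract_emb 0 = 0" "fract_emb 1 = 1"
    by (simp_all add: fract_emb_def Zero_fract_def One_fract_def one_pCons)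
  show "fract_emb (a + b) = fract_emb a + fract_emb b" for a b
    by (simp add: fract_emb_def Poly_Mapping.single_add)
  show "fract_emb (a * b) = fract_emb a * fract_emb b" for a b
    by (simp add: fract_emb_def Poly_Mapping.mult_single mult.commute)
next
  fix p :: "'v exponent \<Rightarrow>\<^sub>0 'k"
  assume 0: "(\<Sum>u\<in>Poly_Mapping.keys p. fract_emb (Poly_Mapping.lookup p u) * fract_mon u) =
      (0 :: ('v, 'k) laurent_t fract)"
  obtain N where N: "\<And>u. u \<in> Poly_Mapping.keys p \<Longrightarrow> 0 \<le> snd u + N"
  proof
    let ?N = "Max (insert 0 ((\<lambda>u. - snd u) ` Poly_Mapping.keys p))"
    fix u assume "u \<in> Poly_Mapping.keys p"
    then have "- snd u \<le> ?N"
      by (intro Max_ge) auto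
    then show "0 \<le> snd u + ?N"
      by linarith
  qed
  define q :: "('v, 'k) laurent_t" where
    "q = (\<Sum>u\<in>Poly_Mapping.keys p. Polynomial.monom (Poly_Mapping.single (fst u) (Poly_Mapping.lookup p u)) (nat (snd u + N)))"
  have "Fract q 1 = (\<Sum>u\<in>Poly_Mapping.keys p. fract_emb (Poly_Mapping.lookup p u) * fract_mon (u + (0, N)))"
    using N by (simp add: q_def Fract_one_sum fract_emb_mult_mon)
  also have "\<dots> = (\<Sum>u\<in>Poly_Mapping.keys p. fract_emb (Poly_Mapping.lookup p u) * fract_mon u) * fract_mon (0, N)"
    by (simp add: fract_mon_add sum_distrib_right mult.assoc)
  finally have "q = 0"
    by (simp add: 0 Fract_one_eq_0_iff)
  show "p = 0"
  proof (rule ccontr)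
    assume "p \<noteq> 0"
    then obtain w where w: "w \<in> Poly_Mapping.keys p"
      by (metis Poly_Mapping.keys_eq_empty ex_in_conv)
    have eq: "nat (snd u + N) = nat (snd w + N) \<and> fst u = fst w \<longleftrightarrow> u = w" if "u \<in> Poly_Mapping.keys p" for u
      using N[OF that] N[OF w] by (auto simp: prod_eq_iff)
    have "Poly_Mapping.lookup (Polynomial.coeff q (nat (snd w + N))) (fst w) =
        (\<Sum>u\<in>Poly_Mapping.keys p. if u = w then Poly_Mapping.lookup p u else 0)"
      unfolding q_def Polynomial.coeff_sum Poly_Mapping.lookup_sum
      by (rule sum.cong[OF refl]) (use eq in \<open>auto simp: Polynomial.coeff_monom Poly_Mapping.lookup_single when_def\<close>)
    then show False
      using w \<open>q = 0\<close> by (simp add: in_keys_iff)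
  qed
qed

interpretation L: laurent_monomials
  "fract_mon :: 'v::{finite,linorder} exponent \<Rightarrow> ('v, 'k::field) laurent_t fract" fract_emb
  by (rule laurent_monomials_fract)

lemma Fract_one_in_span: "Fract p 1 \<in> L.monomial_span UNIV"
proof -
  have "Fract (Polynomial.monom l i) 1 \<in> L.monomial_span UNIV" for l :: "('a \<Rightarrow>\<^sub>0 int) \<Rightarrow>\<^sub>0 'b" and i
  proof -
    have "Polynomial.monom l i =
        (\<Sum>a\<in>Poly_Mapping.keys l. Polynomial.monom (Poly_Mapping.single a (Poly_Mapping.lookup l a)) i)"
      by (subst poly_mapping_sum_single[of l]) (simp add: Polynomial.monom_sum)
    then have "Fract (Polynomial.monom l i) 1 =
        (\<Sum>a\<in>Poly_Mapping.keys l. fract_emb (Poly_Mapping.lookup l a) * fract_mon (a, int i))"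
      by (simp add: Fract_one_sum fract_emb_mult_mon)
    then show ?thesis
      by (auto intro: L.span_sum L.span_emb_mon)
  qed
  then have "(\<Sum>i\<le>Polynomial.degree p. Fract (Polynomial.monom (Polynomial.coeff p i) i) 1) \<in> L.monomial_span UNIV"
    by (intro L.span_sum)
  then show ?thesis
    by (simp only: Fract_one_sum[symmetric] Polynomial.poly_as_sum_of_monoms)
qed

lemma span_fractions:
  fixes y :: "('v::{finite,linorder}, 'k::field) laurent_t fract"
  shows "\<exists>a b. a \<in> L.monomial_span UNIV \<and> b \<in> L.monomial_span UNIV \<and> b \<noteq> 0 \<and> y = a / b"
proof (cases y)
  case (Fract p q)
  then show ?thesis
    by (intro exI[of _ "Fract p 1"] exI[of _ "Fract q 1"]) (simp add: Fract_one_in_span Fract_one_eq_0_iff)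
qed

text \<open>A Laurent extension along each coordinate in turn, starting from the scalars.
  \<open>?H S\<close> is the group of exponents in the variables indexed by \<open>S\<close>; the
  variable \<open>t\<close> comes last.\<close>

lemma complete_gcd_laurent_ring:
  "complete_gcd_ring (L.monomial_span UNIV :: ('v::{finite,linorder}, 'k::field) laurent_t fract set)"
proof -
  let ?H = "\<lambda>S. {u :: 'v exponent. Poly_Mapping.keys (fst u) \<subseteq> S \<and> snd u = 0}"
  have sub: "u - v \<in> ?H S" if "u \<in> ?H S" "v \<in> ?H S" for S u v
    using that by (auto simp: in_keys_iff Poly_Mapping.lookup_minus subset_iff) (metis diff_zero)
  have coordinates: "complete_gcd_ring (L.monomial_span (?H S) :: ('v, 'k) laurent_t fract set)" if "finite S" for S
    using that
  proof (induction S rule: finite_induct)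
    case empty
    have "?H {} = {0}"
      by (auto simp: prod_eq_iff)
    then show ?case
      using L.complete_gcd_scalars by simp
  next
    case (insert v S)
    let ?z = "\<lambda>i::int. (Poly_Mapping.single v i, 0::int)"
    have "complete_gcd_ring (L.monomial_span {h + ?z i | h i. h \<in> ?H S} :: ('v, 'k) laurent_t fract set)"
    proof (rule L.complete_gcd_adjoin[OF insert.IH _ sub])
      show "?z (i + j) = ?z i + ?z j" for i j
        by (simp add: Poly_Mapping.single_add)
      show "i = 0" if "?z i \<in> ?H S" for i
        using that insert.hyps by (auto split: if_splits)
    qed auto
    also have "{h + ?z i | h i. h \<in> ?H S} = ?H (insert v S)"
    proof (intro equalityI subsetI)
      fix u assume "u \<in> {h + ?z i | h i. h \<in> ?H S}"
      then show "u \<in> ?H (insert v S)"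
        using Poly_Mapping.keys_add by (fastforce split: if_splits)
    next
      fix u assume u: "u \<in> ?H (insert v S)"
      let ?i = "Poly_Mapping.lookup (fst u) v"
      have "Poly_Mapping.keys (fst u - Poly_Mapping.single v ?i) \<subseteq> S"
      proof
        fix w assume "w \<in> Poly_Mapping.keys (fst u - Poly_Mapping.single v ?i)"
        then show "w \<in> S"
          using u by (auto simp: in_keys_iff Poly_Mapping.lookup_minus Poly_Mapping.lookup_single when_def
              subset_iff split: if_splits)
      qed
      then have "u - ?z ?i \<in> ?H S" "u = u - ?z ?i + ?z ?i"
        using u by (simp_all add: prod_eq_iff)
      then show "u \<in> {h + ?z i | h i. h \<in> ?H S}"
        by blast
    qed
    finally show ?case .
  qed
  have gcd: "complete_gcd_ring (L.monomial_span (?H UNIV) :: ('v, 'k) laurent_t fract set)"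
    by (rule coordinates) simp
  let ?z = "\<lambda>i::int. (0 :: 'v \<Rightarrow>\<^sub>0 int, i)"
  have "complete_gcd_ring (L.monomial_span {h + ?z i | h i. h \<in> ?H UNIV} :: ('v, 'k) laurent_t fract set)"
    by (rule L.complete_gcd_adjoin[OF gcd _ sub]) auto
  also have "{h + ?z i | h i. h \<in> ?H UNIV} = UNIV"
  proof -
    have "u = (fst u, 0) + ?z (snd u)" "(fst u, 0) \<in> ?H UNIV" for u
      by (simp_all add: prod_eq_iff)
    then show ?thesis by blast
  qed
  finally show ?thesis .
qed

section \<open>The stable set ring\<close>

text \<open>
  The exponents \<open>(a, m)\<close> of the stable set ring of a perfect graph: the clique inequalities describe
  the cone over the polytope, and replication shows that its lattice points are sums of stable sets.
\<close>

definition stable_cone :: "('v::finite \<Rightarrow> 'v \<Rightarrow> bool) \<Rightarrow> 'v exponent set" where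
  "stable_cone E = {u. (\<forall>v. 0 \<le> Poly_Mapping.lookup (fst u) v) \<and>
    (\<forall>C. clique E C \<longrightarrow> (\<Sum>v\<in>C. Poly_Mapping.lookup (fst u) v) \<le> snd u)}"

lemma zero_in_stable_cone: "0 \<in> stable_cone E"
  by (simp add: stable_cone_def)

lemma stable_cone_add: "u \<in> stable_cone E \<Longrightarrow> v \<in> stable_cone E \<Longrightarrow> u + v \<in> stable_cone E"
  by (auto simp: stable_cone_def Poly_Mapping.lookup_add sum.distrib intro: add_mono)

lemma polytope_point_in_stable_cone:
  assumes "lattice_point a \<in> stable_set_polytope E"
  shows "(a, 1) \<in> stable_cone E"
proof -
  have "0 \<le> Poly_Mapping.lookup a v" for v
    using stable_set_polytope_inequalities(1)[OF assms, of v] by (simp add: lattice_point_def)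
  moreover have "(\<Sum>v\<in>C. Poly_Mapping.lookup a v) \<le> 1" if "clique E C" for C
  proof -
    have "real_of_int (\<Sum>v\<in>C. Poly_Mapping.lookup a v) \<le> 1"
      using stable_set_polytope_inequalities(2)[OF assms that] by (simp add: lattice_point_def)
    then show ?thesis by linarith
  qed
  ultimately show ?thesis
    by (simp add: stable_cone_def)
qed

lemma Fract_toric_algebra_in_span:
  fixes p :: "('v::{finite,linorder}, 'k::field) laurent_t"
  assumes "p \<in> toric_algebra (stable_set_polytope E)"
  shows "Fract p 1 \<in> L.monomial_span (stable_cone E)"
  using assms
proof induction
  case (scalar c)
  have "Fract [:Poly_Mapping.single 0 c:] 1 = fract_emb c * (fract_mon 0 :: ('v, 'k) laurent_t fract)"
    using fract_emb_mult_mon[of "0 :: 'v exponent" c] by (simp add: Polynomial.monom_0)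
  then show ?case
    by (simp only: L.span_emb_mon[OF zero_in_stable_cone])
next
  case (gen a)
  have "Fract (Polynomial.monom (Poly_Mapping.single a 1) 1) 1 = fract_emb (1 :: 'k) * fract_mon (a, 1)"
    using fract_emb_mult_mon[of "(a, 1)" "1 :: 'k"] by simp
  then show ?case
    by (simp only: L.span_emb_mon[OF polytope_point_in_stable_cone[OF gen]])
next
  case (add p q)
  then show ?case
    unfolding Fract_one_add by (intro L.span_add)
next
  case (mult p q)
  then show ?case
    unfolding Fract_one_mult by (intro L.span_mult[OF _ _ stable_cone_add])
qed

lemma stable_set_ring_eq_span:
  fixes E :: "'v::{finite,linorder} \<Rightarrow> 'v \<Rightarrow> bool"
  assumes "irreflp E" "perfect_graph E"
  shows "stable_set_ring TYPE('k::field) E = L.monomial_span (stable_cone E)"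
proof (intro equalityI subsetI)
  fix y :: "('v, 'k) laurent_t fract" assume "y \<in> stable_set_ring TYPE('k) E"
  then show "y \<in> L.monomial_span (stable_cone E)"
    by (auto simp: stable_set_ring_def toric_ring_def Fract_toric_algebra_in_span)
next
  let ?T = "toric_algebra (stable_set_polytope E) :: ('v, 'k) laurent_t set"
  let ?R = "stable_set_ring TYPE('k) E"
  have R: "?R = (\<lambda>p. Fract p 1) ` ?T"
    by (simp add: stable_set_ring_def toric_ring_def)
  have R_emb: "fract_emb c \<in> ?R" for c
    unfolding R fract_emb_def by (intro imageI toric_algebra.scalar)
  have R_add: "x + y \<in> ?R" if "x \<in> ?R" "y \<in> ?R" for x y
    using that unfolding R by (auto simp: toric_algebra.add simp del: add_fract simp flip: Fract_one_add)
  have R_mult: "x * y \<in> ?R" if "x \<in> ?R" "y \<in> ?R" for x y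
    using that unfolding R by (auto simp: toric_algebra.mult simp del: mult_fract simp flip: Fract_one_mult)
  have R_zero: "0 \<in> ?R"
    using R_emb[of 0] by (simp only: L.emb_zero)
  have R_sum: "sum f B \<in> ?R" if "\<And>b. b \<in> B \<Longrightarrow> f b \<in> ?R" for f and B :: "'v exponent set"
    using that by (induction B rule: infinite_finite_induct) (auto intro: R_zero R_add)
  define \<rho> :: "'v set \<Rightarrow> 'v \<Rightarrow>\<^sub>0 int" where "\<rho> W = Abs_poly_mapping (\<lambda>v. of_bool (v \<in> W))" for W
  have \<rho>: "Poly_Mapping.lookup (\<rho> W) v = of_bool (v \<in> W)" for W v
    unfolding \<rho>_def by (subst Poly_Mapping.lookup_Abs_poly_mapping) simp_all
  have "fract_mon (\<rho> W, 1) \<in> ?R" if "stable_set E W" for W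
  proof -
    have "lattice_point (\<rho> W) = incidence_vector W"
      by (simp add: vec_eq_iff lattice_point_def \<rho> incidence_vector_def axis_def of_bool_def sum.delta)
    then have "Polynomial.monom (Poly_Mapping.single (\<rho> W) 1) 1 \<in> ?T"
      using incidence_vector_in_polytope[OF that] by (intro toric_algebra.gen) simp
    moreover have "fract_mon (\<rho> W, 1) = Fract (Polynomial.monom (Poly_Mapping.single (\<rho> W) (1::'k)) 1) 1"
      using fract_emb_mult_mon[of "(\<rho> W, 1)" "1::'k"] by (simp add: L.emb_one)
    ultimately show ?thesis
      unfolding R by blast
  qed
  then have R_sum_mon: "fract_mon (\<Sum>j<m. (\<rho> (W j), 1)) \<in> ?R" if "\<forall>j<m. stable_set E (W j)" for m :: nat and W
    using that
    by (induction m) (auto simp: L.mon_zero fract_mon_add intro!: R_mult R_emb[of 1, unfolded L.emb_one])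
  have R_mon: "fract_mon u \<in> ?R" if u: "u \<in> stable_cone E" for u
  proof -
    obtain a k where ak: "u = (a, k)"
      by (cases u)
    have a0: "0 \<le> Poly_Mapping.lookup a v" for v
      using u by (simp add: stable_cone_def ak)
    have cl: "(\<Sum>v\<in>C. Poly_Mapping.lookup a v) \<le> k" if "clique E C" for C
      using u that by (simp add: stable_cone_def ak)
    \<comment> \<open>The empty clique is what keeps the degree in \<open>t\<close>
      nonnegative.\<close>
    have k0: "0 \<le> k"
      using cl[of "{}"] by (simp add: clique_def)
    have "(\<Sum>v\<in>C. nat (Poly_Mapping.lookup a v)) \<le> nat k" if "clique E C" for C
    proof -
      have "int (\<Sum>v\<in>C. nat (Poly_Mapping.lookup a v)) \<le> k"
        using cl[OF that] a0 by simp
      then show ?thesis using k0 by linarith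
    qed
    \<comment> \<open>A cover by exactly \<open>k\<close> stable sets writes the monomial as a
      product of \<open>k\<close> generators, each of degree one in \<open>t\<close>; for
      \<open>k = 0\<close> the product is empty.\<close>
    then obtain W where W: "\<forall>j<nat k. stable_set E (W j)"
      "\<And>v. (\<Sum>j<nat k. of_bool (v \<in> W j)) = nat (Poly_Mapping.lookup a v)"
      using perfect_graph_stable_cover[OF assms, of "\<lambda>v. nat (Poly_Mapping.lookup a v)" "nat k"] by blast
    have "a = (\<Sum>j<nat k. \<rho> (W j))"
    proof (rule poly_mapping_eqI)
      fix v
      have "Poly_Mapping.lookup a v = int (\<Sum>j<nat k. of_bool (v \<in> W j))"
        unfolding W(2) using a0[of v] by simp
      then show "Poly_Mapping.lookup a v = Poly_Mapping.lookup (\<Sum>j<nat k. \<rho> (W j)) v"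
        by (simp only: Poly_Mapping.lookup_sum \<rho> of_nat_sum of_nat_of_bool)
    qed
    moreover have "k = (\<Sum>j<nat k. 1)"
      using k0 by simp
    ultimately have "u = (\<Sum>j<nat k. (\<rho> (W j), 1))"
      by (simp add: ak prod_eq_iff fst_sum snd_sum)
    then show ?thesis
      using R_sum_mon[OF W(1)] by simp
  qed
  fix y :: "('v, 'k) laurent_t fract" assume "y \<in> L.monomial_span (stable_cone E)"
  then obtain c where c: "y = (\<Sum>u\<in>L.supp y. fract_emb (c u) * fract_mon u)" "L.supp y \<subseteq> stable_cone E"
    by (rule L.span_expand)
  show "y \<in> ?R"
    by (subst c(1)) (intro R_sum R_mult R_emb R_mon subsetD[OF c(2)])
qed

fun facet_form :: "(nat \<Rightarrow> 'v set) \<Rightarrow> 'v + nat \<Rightarrow> 'v::finite exponent \<Rightarrow> int" where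
  "facet_form Q (Inl v) u = Poly_Mapping.lookup (fst u) v"
| "facet_form Q (Inr j) u = snd u - (\<Sum>v\<in>Q j. Poly_Mapping.lookup (fst u) v)"

lemma facet_form_add: "facet_form Q i (u + v) = facet_form Q i u + facet_form Q i v"
  by (cases i) (simp_all add: Poly_Mapping.lookup_add sum.distrib)

text \<open>
  For the facet of a clique \<open>Q j\<close> the entries of \<open>a\<close> on \<open>Q j\<close> are raised by a large \<open>N\<close>: by maximality
  every other \<open>Q l\<close> misses a vertex of \<open>Q j\<close>, so its inequality becomes slack.
\<close>

lemma facet_form_facet:
  fixes Q :: "nat \<Rightarrow> 'v::finite set" and b :: "'v + nat \<Rightarrow> int"
  assumes Q: "\<And>j l. j \<le> n \<Longrightarrow> l \<le> n \<Longrightarrow> Q j \<subseteq> Q l \<Longrightarrow> j = l"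
    and i: "i \<in> range Inl \<union> Inr ` {0..n}"
  shows "\<exists>u. facet_form Q i u = b i \<and> (\<forall>i'\<in>range Inl \<union> Inr ` {0..n}. b i' \<le> facet_form Q i' u)"
proof -
  define mk where "mk f = Abs_poly_mapping f" for f :: "'v \<Rightarrow> int"
  have mk: "Poly_Mapping.lookup (mk f) = f" for f
    unfolding mk_def by (rule Poly_Mapping.lookup_Abs_poly_mapping) simp
  \<comment> \<open>\<open>B l\<close> is the last coordinate at which the inequality of
    \<open>Q l\<close> is tight when the vertex entries equal their bounds; \<open>M\<close>
    suffices for all cliques at once.\<close>
  define B where "B l = b (Inr l) + (\<Sum>v\<in>Q l. b (Inl v))" for l
  define M where "M = Max (B ` {0..n})"
  have M: "B l \<le> M" if "l \<le> n" for l
    unfolding M_def using that by (intro Max_ge) auto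
  show ?thesis
  proof (cases i)
    case (Inl v)
    have "b (Inr l) \<le> M - (\<Sum>v\<in>Q l. b (Inl v))" if "l \<le> n" for l
      using M[OF that] by (simp add: B_def)
    then show ?thesis
      using Inl by (intro exI[of _ "(mk (\<lambda>v. b (Inl v)), M)"]) (auto simp: mk)
  next
    case (Inr j)
    then have j: "j \<le> n"
      using i by auto
    \<comment> \<open>A single vertex of \<open>Q j\<close> missing from \<open>Q l\<close> provides
      the slack \<open>M - B j\<close>, which covers the deficit \<open>B l - B j\<close>.\<close>
    define N where "N = M - B j"
    have N0: "0 \<le> N"
      using M[OF j] by (simp add: N_def)
    define a where "a v = b (Inl v) + N * of_bool (v \<in> Q j)" for v
    have sum_a: "(\<Sum>v\<in>Q l. a v) = (\<Sum>v\<in>Q l. b (Inl v)) + N * int (card (Q l \<inter> Q j))" for l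
      by (simp add: a_def sum.distrib sum_of_bool_eq flip: sum_distrib_left)
    have "b (Inr l) \<le> b (Inr j) + (\<Sum>v\<in>Q j. a v) - (\<Sum>v\<in>Q l. a v)" if l: "l \<le> n" for l
    proof (cases "l = j")
      case False
      then have "Q l \<inter> Q j \<subset> Q j"
        using Q[OF j l] by auto
      then have "card (Q l \<inter> Q j) < card (Q j)"
        by (intro psubset_card_mono) auto
      then have "N * 1 \<le> N * (int (card (Q j)) - int (card (Q l \<inter> Q j)))"
        using N0 by (intro mult_left_mono) auto
      then have "M - B j \<le> N * int (card (Q j)) - N * int (card (Q l \<inter> Q j))"
        by (simp add: right_diff_distrib N_def)
      then show ?thesis
        using M[OF l] by (simp add: sum_a B_def)
    qed simp
    moreover have "b (Inl v) \<le> a v" for v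
      using N0 by (simp add: a_def)
    ultimately show ?thesis
      using Inr by (intro exI[of _ "(mk a, b (Inr j) + (\<Sum>v\<in>Q j. a v))"]) (auto simp: mk)
  qed
qed

lemma normal_toric_ring_facet_form:
  fixes Q :: "nat \<Rightarrow> 'v::{finite,linorder} set"
  assumes "\<And>j l. j \<le> n \<Longrightarrow> l \<le> n \<Longrightarrow> Q j \<subseteq> Q l \<Longrightarrow> j = l"
  shows "normal_toric_ring (fract_mon :: _ \<Rightarrow> ('v, 'k::field) laurent_t fract) fract_emb
    (range Inl \<union> Inr ` {0..n}) (facet_form Q)"
proof (rule normal_toric_ring.intro[OF laurent_monomials_fract normal_toric_ring_axioms.intro])
  show "facet_form Q i (u + v) = facet_form Q i u + facet_form Q i v" for i u v
    by (rule facet_form_add)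
  show "\<exists>u. facet_form Q i u = b i \<and> (\<forall>j\<in>range Inl \<union> Inr ` {0..n}. b j \<le> facet_form Q j u)"
    if "i \<in> range Inl \<union> Inr ` {0..n}" for i b
    using assms that by (rule facet_form_facet)
  show "u = 0" if 0: "\<And>i. i \<in> range Inl \<union> Inr ` {0..n} \<Longrightarrow> facet_form Q i u = 0" for u
  proof -
    have a: "Poly_Mapping.lookup (fst u) v = 0" for v
      using 0[of "Inl v"] by simp
    then have "fst u = 0"
      by (intro poly_mapping_eqI) simp
    moreover have "snd u = 0"
      using 0[of "Inr 0"] a by simp
    ultimately show ?thesis
      by (simp add: prod_eq_iff)
  qed
  show "complete_gcd_ring (L.monomial_span UNIV :: ('v, 'k) laurent_t fract set)"
    by (rule complete_gcd_laurent_ring)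
  show "\<exists>a b. a \<in> L.monomial_span UNIV \<and> b \<in> L.monomial_span UNIV \<and> b \<noteq> 0 \<and> y = a / b"
    for y :: "('v, 'k) laurent_t fract"
    by (rule span_fractions)
qed

text \<open>Entries are nonnegative, so enlarging a clique only strengthens its inequality, and the
  maximal cliques imply the rest.\<close>

lemma stable_cone_eq_facets:
  fixes E :: "'v::finite \<Rightarrow> 'v \<Rightarrow> bool"
  assumes Q: "Q ` {0..n} = {C. maximal_clique E C}"
  shows "stable_cone E = {u. \<forall>i\<in>range Inl \<union> Inr ` {0..n}. 0 \<le> facet_form Q i u}"
proof -
  have "(\<forall>C. clique E C \<longrightarrow> (\<Sum>v\<in>C. Poly_Mapping.lookup a v) \<le> m) \<longleftrightarrow>
      (\<forall>j\<in>{0..n}. (\<Sum>v\<in>Q j. Poly_Mapping.lookup a v) \<le> m)"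
    if a: "\<forall>v. 0 \<le> Poly_Mapping.lookup a v" for a :: "'v \<Rightarrow>\<^sub>0 int" and m
  proof (intro iffI allI impI ballI)
    fix j assume *: "\<forall>C. clique E C \<longrightarrow> (\<Sum>v\<in>C. Poly_Mapping.lookup a v) \<le> m" and "j \<in> {0..n}"
    then have "maximal_clique E (Q j)"
      using Q by blast
    with * show "(\<Sum>v\<in>Q j. Poly_Mapping.lookup a v) \<le> m"
      by (simp add: maximal_clique_def)
  next
    fix C assume *: "\<forall>j\<in>{0..n}. (\<Sum>v\<in>Q j. Poly_Mapping.lookup a v) \<le> m" and "clique E C"
    then obtain D where "maximal_clique E D" "C \<subseteq> D"
      using ex_maximal_clique by blast
    moreover from this(1) have "D \<in> Q ` {0..n}"
      by (simp add: Q)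
    ultimately obtain j where j: "j \<in> {0..n}" "C \<subseteq> Q j"
      by auto
    have "(\<Sum>v\<in>C. Poly_Mapping.lookup a v) \<le> (\<Sum>v\<in>Q j. Poly_Mapping.lookup a v)"
      using j(2) a by (intro sum_mono2) auto
    with bspec[OF * j(1)] show "(\<Sum>v\<in>C. Poly_Mapping.lookup a v) \<le> m"
      by linarith
  qed
  then show ?thesis
    by (auto simp: stable_cone_def ball_Un)
qed

theorem proposition3p1:
  fixes E :: "'v::{finite,linorder} \<Rightarrow> 'v \<Rightarrow> bool"
    and Q :: "nat \<Rightarrow> 'v set"
    and n :: nat
  assumes "simple_graph E"
    and "perfect_graph E"
    and "bij_betw Q {0..n} {C. maximal_clique E C}"
  shows "comm_group (class_group (stable_set_ring TYPE('k::field) E)) \<and>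
    class_group (stable_set_ring TYPE('k) E) \<cong> product_group {1..n} (\<lambda>_. integer_group) \<and>
    torsion_free (class_group (stable_set_ring TYPE('k) E))"
proof -
  let ?facets = "range Inl \<union> Inr ` {0..n} :: ('v + nat) set"
  \<comment> \<open>The map from an exponent to its values on \<open>?base\<close> is triangular
    with unit diagonal, hence bijective on the lattice.\<close>
  let ?base = "insert (Inr 0) (range Inl) :: ('v + nat) set"
  have Q: "Q ` {0..n} = {C. maximal_clique E C}" "inj_on Q {0..n}"
    using assms(3) by (auto simp: bij_betw_def)
  \<comment> \<open>Incomparability of distinct maximal cliques is the irredundancy behind
    \<open>facet\<close>.\<close>
  have incomparable: "j = l" if "j \<le> n" "l \<le> n" "Q j \<subseteq> Q l" for j l
  proof -
    have "maximal_clique E (Q j)" "maximal_clique E (Q l)"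
      using that Q(1) by auto
    then have "Q l = Q j"
      using that(3) by (auto simp: maximal_clique_def)
    then show ?thesis
      using that(1,2) by (auto intro: inj_onD[OF Q(2)])
  qed
  interpret T: normal_toric_ring "fract_mon :: _ \<Rightarrow> ('v, 'k) laurent_t fract" fract_emb ?facets "facet_form Q"
    using incomparable by (rule normal_toric_ring_facet_form)
  have A: "stable_set_ring TYPE('k) E = T.A"
    using assms(1,2) stable_cone_eq_facets[OF Q(1)]
    by (simp add: stable_set_ring_eq_span simple_graph_def T.D_def)
  have "class_group T.A \<cong> product_group {1..n} (\<lambda>_. integer_group)"
  proof (rule T.class_group_iso)
    show "?base \<subseteq> ?facets"
      by auto
    show "\<exists>u. \<forall>i\<in>?base. facet_form Q i u = b i" for b
    proof -
      have "Poly_Mapping.lookup (Abs_poly_mapping (\<lambda>v. b (Inl v))) = (\<lambda>v. b (Inl v))"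
        by (rule Poly_Mapping.lookup_Abs_poly_mapping) simp
      then show ?thesis
        by (intro exI[of _ "(Abs_poly_mapping (\<lambda>v. b (Inl v)), b (Inr 0) + (\<Sum>v\<in>Q 0. b (Inl v)))"]) auto
    qed
    show "u = 0" if 0: "\<And>i. i \<in> ?base \<Longrightarrow> facet_form Q i u = 0" for u
    proof -
      have a: "Poly_Mapping.lookup (fst u) v = 0" for v
        using 0[of "Inl v"] by simp
      then have "fst u = 0"
        by (intro poly_mapping_eqI) simp
      moreover have "snd u = 0"
        using 0[of "Inr 0"] a by simp
      ultimately show ?thesis
        by (simp add: prod_eq_iff)
    qed
    show "bij_betw Inr {1..n} (?facets - ?base)"
      by (auto simp: bij_betw_def)
  qed
  then show ?thesis
    unfolding A using T.comm_group_class_group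
    by (auto intro: torsion_free_of_iso_product_integers comm_group.axioms(2))
qed

end
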